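(* Let $H$ be a complex separable Hilbert space and let $L\colon \operatorname{Dom}(L)\subset H\to H$ be a (densely defined) self-adjoint linear operator such that (a) $0=\inf\sigma_e(L)$, where $\sigma_e(L)$ is the essential spectrum of $L$; (b) $(-\delta,0)\subset\rho(L)$ for some $\delta>0$; (c) $\inf\sigma(L)=-\gamma$ for some (finite) $\gamma\geqslant0$. Let $N\colon H\to H$ be bounded, demicontinuous and quasi-monotone with $$\lim_{k\to\infty}\frac{\|N(u_k)\|}{\|u_k\|}=0$$ for each sequence $\{u_k\}_{k\in\mathbb{N}}\subset H$ such that $\|u_k\|\to+\infty$. Then for all $0<\varepsilon<1$ and all $h\in H$ the equation $$\varepsilon P_2u+Lu+N(u)=h$$ has a solution $u\in\operatorname{Dom}(L)$, where $P_2$ is the orthogonal projection onto $H_2$ defined in the context.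
   Context: Notation: $\langle u,v\rangle_r=\operatorname{Re}\langle u,v\rangle$; $\rightharpoonup$ is weak convergence, $\to$ norm convergence. The essential spectrum of a self-adjoint $L$ is the set of $\lambda\in\sigma(L)$ that are accumulation points of $\sigma(L)$ or eigenvalues of infinite multiplicity. $N$ is bounded if it maps bounded sets to bounded sets; demicontinuous if $u_k\to u_0$ implies $N(u_k)\rightharpoonup N(u_0)$; quasi-monotone if $u_k\rightharpoonup u_0$ implies $\limsup_k\langle N(u_k),u_k-u_0\rangle_r\geqslant0$. Let $\{E_\mu\}_{\mu\in\mathbb{R}}$ be the (right-continuous) spectral family of $L$ and $E_{0-}$ the strong limit of $E_{-1/k}$ as $k\to\infty$; put $H_1=\operatorname{Ran}(E_{-\delta})$, $H_2=\operatorname{Ker}E_{0-}$. Then $H=H_1\oplus H_2$ orthogonally, and $P_2$ is the orthogonal projection of $H$ onto $H_2$. *)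

theory Defs
  imports "HOL-Analysis.Analysis"
begin

section \<open>Complex Hilbert spaces\<close>

text \<open>The inner product is linear in the first argument. The real inner product of the
  library is the real part of the complex one, so that norm and topology are those of
  the library; positivity and definiteness are inherited from \<^class>\<open>real_inner\<close>.\<close>

class complex_inner = real_inner +
  fixes scaleC :: "complex \<Rightarrow> 'a \<Rightarrow> 'a"  (infixr "*\<^sub>C" 75)
    and cinner :: "'a \<Rightarrow> 'a \<Rightarrow> complex"
  assumes scaleC_add_right: "a *\<^sub>C (x + y) = a *\<^sub>C x + a *\<^sub>C y"
    and scaleC_add_left: "(a + b) *\<^sub>C x = a *\<^sub>C x + b *\<^sub>C x"
    and scaleC_scaleC: "a *\<^sub>C b *\<^sub>C x = (a * b) *\<^sub>C x"
    and scaleR_scaleC: "r *\<^sub>R x = complex_of_real r *\<^sub>C x"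
    and cinner_commute: "cinner x y = cnj (cinner y x)"
    and cinner_add_left: "cinner (x + y) z = cinner x z + cinner y z"
    and cinner_scaleC_left: "cinner (a *\<^sub>C x) y = a * cinner x y"
    and inner_eq_Re_cinner: "x \<bullet> y = Re (cinner x y)"

class chilbert_space = complex_inner + complete_space

lemma vector_space_scaleC:
  "vector_space (scaleC :: complex \<Rightarrow> 'a \<Rightarrow> 'a::complex_inner)"
proof
  show "1 *\<^sub>C x = x" for x :: 'a
    using scaleR_scaleC[of 1 x] by simp
qed (simp_all add: scaleC_add_right scaleC_add_left scaleC_scaleC)

global_interpretation complex_vector: vector_space
  "scaleC :: complex \<Rightarrow> 'a \<Rightarrow> 'a::complex_inner"
  defines csubspace = complex_vector.subspace
    and cspan = complex_vector.span
  by (rule vector_space_scaleC)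

section \<open>Unbounded operators\<close>

text \<open>An operator is given by its domain \<open>D\<close> and a total function \<open>L\<close>; the values of
  \<open>L\<close> outside \<open>D\<close> are irrelevant.\<close>

definition linear_operator :: "'a::complex_inner set \<Rightarrow> ('a \<Rightarrow> 'a) \<Rightarrow> bool" where
  "linear_operator D L \<longleftrightarrow> csubspace D \<and>
     (\<forall>x\<in>D. \<forall>y\<in>D. L (x + y) = L x + L y) \<and> (\<forall>c. \<forall>x\<in>D. L (c *\<^sub>C x) = c *\<^sub>C L x)"

definition operator_graph :: "'a set \<Rightarrow> ('a \<Rightarrow> 'a) \<Rightarrow> ('a \<times> 'a) set" where
  "operator_graph D L = {(x, L x) | x. x \<in> D}"

text \<open>The graph of the Hilbert space adjoint (for densely defined \<open>L\<close>).\<close>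

definition adjoint_graph :: "'a::complex_inner set \<Rightarrow> ('a \<Rightarrow> 'a) \<Rightarrow> ('a \<times> 'a) set" where
  "adjoint_graph D L = {(y, z). \<forall>x\<in>D. cinner (L x) y = cinner x z}"

definition self_adjoint :: "'a::complex_inner set \<Rightarrow> ('a \<Rightarrow> 'a) \<Rightarrow> bool" where
  "self_adjoint D L \<longleftrightarrow> linear_operator D L \<and> closure D = UNIV \<and>
     adjoint_graph D L = operator_graph D L"

definition resolvent_set :: "'a::complex_inner set \<Rightarrow> ('a \<Rightarrow> 'a) \<Rightarrow> complex set" where
  "resolvent_set D L = {z. bij_betw (\<lambda>x. L x - z *\<^sub>C x) D UNIV \<and>
     bounded_linear (inv_into D (\<lambda>x. L x - z *\<^sub>C x))}"

definition spectrum :: "'a::complex_inner set \<Rightarrow> ('a \<Rightarrow> 'a) \<Rightarrow> complex set" where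
  "spectrum D L = - resolvent_set D L"

definition eigenspace :: "'a::complex_inner set \<Rightarrow> ('a \<Rightarrow> 'a) \<Rightarrow> complex \<Rightarrow> 'a set" where
  "eigenspace D L z = {x \<in> D. L x = z *\<^sub>C x}"

definition essential_spectrum :: "'a::complex_inner set \<Rightarrow> ('a \<Rightarrow> 'a) \<Rightarrow> complex set" where
  "essential_spectrum D L = {z \<in> spectrum D L. z islimpt spectrum D L \<or>
     \<not> (\<exists>B. finite B \<and> eigenspace D L z = cspan B)}"

section \<open>Spectral families\<close>

definition orthogonal_projection :: "('a::complex_inner \<Rightarrow> 'a) \<Rightarrow> bool" where
  "orthogonal_projection P \<longleftrightarrow> Vector_Spaces.linear scaleC scaleC P \<and>
     (\<forall>x. P (P x) = P x) \<and> (\<forall>x y. cinner (P x) y = cinner x (P y))"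

definition spectral_family :: "(real \<Rightarrow> 'a::complex_inner \<Rightarrow> 'a) \<Rightarrow> bool" where
  "spectral_family E \<longleftrightarrow> (\<forall>\<mu>. orthogonal_projection (E \<mu>)) \<and>
     (\<forall>\<mu> \<nu> x. E \<mu> (E \<nu> x) = E (min \<mu> \<nu>) x) \<and>
     (\<forall>\<mu> x. ((\<lambda>\<nu>. E \<nu> x) \<longlongrightarrow> E \<mu> x) (at_right \<mu>)) \<and>
     (\<forall>x. ((\<lambda>\<mu>. E \<mu> x) \<longlongrightarrow> 0) at_bot) \<and>
     (\<forall>x. ((\<lambda>\<mu>. E \<mu> x) \<longlongrightarrow> x) at_top)"

text \<open>The Lebesgue--Stieltjes measure of the function mapping \<open>\<mu>\<close> to
  \<open>\<langle>E\<^sub>\<mu> x, x\<rangle> = \<parallel>E\<^sub>\<mu> x\<parallel>\<^sup>2\<close>, which is nondecreasing and right-continuous.\<close>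

definition stieltjes :: "(real \<Rightarrow> 'a::complex_inner \<Rightarrow> 'a) \<Rightarrow> 'a \<Rightarrow> real measure" where
  "stieltjes E x = interval_measure (\<lambda>\<mu>. (norm (E \<mu> x))\<^sup>2)"

text \<open>\<open>L\<close> is the integral of \<open>\<mu>\<close> with respect to \<open>dE\<^sub>\<mu>\<close>: its domain consists of the \<open>x\<close>
  for which the integral of \<open>\<mu>\<^sup>2\<close> with respect to \<open>d\<langle>E\<^sub>\<mu> x, x\<rangle>\<close> is finite, and \<open>\<langle>L x, x\<rangle>\<close>
  is the integral of \<open>\<mu>\<close> with respect to \<open>d\<langle>E\<^sub>\<mu> x, x\<rangle>\<close>. By polarization and the density of
  \<open>D\<close> these values determine \<open>L\<close> on \<open>D\<close>.\<close>

definition spectral_family_of ::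
  "'a::complex_inner set \<Rightarrow> ('a \<Rightarrow> 'a) \<Rightarrow> (real \<Rightarrow> 'a \<Rightarrow> 'a) \<Rightarrow> bool" where
  "spectral_family_of D L E \<longleftrightarrow> spectral_family E \<and>
     D = {x. integrable (stieltjes E x) (\<lambda>\<mu>. \<mu>\<^sup>2)} \<and>
     (\<forall>x\<in>D. cinner (L x) x = complex_of_real (\<integral>\<mu>. \<mu> \<partial>stieltjes E x))"

definition E_zero_minus :: "(real \<Rightarrow> 'a::complex_inner \<Rightarrow> 'a) \<Rightarrow> 'a \<Rightarrow> 'a" where
  "E_zero_minus E x = lim (\<lambda>k. E (- 1 / real (Suc k)) x)"

definition H2 :: "(real \<Rightarrow> 'a::complex_inner \<Rightarrow> 'a) \<Rightarrow> 'a set" where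
  "H2 E = {x. E_zero_minus E x = 0}"

definition projection_onto :: "'a::complex_inner set \<Rightarrow> 'a \<Rightarrow> 'a" where
  "projection_onto M x = (THE y. y \<in> M \<and> (\<forall>z\<in>M. cinner (x - y) z = 0))"

section \<open>Nonlinear operators\<close>

definition weakly_converges :: "(nat \<Rightarrow> 'a::complex_inner) \<Rightarrow> 'a \<Rightarrow> bool" where
  "weakly_converges u u0 \<longleftrightarrow> (\<forall>v. (\<lambda>k. cinner (u k) v) \<longlonglongrightarrow> cinner u0 v)"

definition bounded_operator :: "('a::complex_inner \<Rightarrow> 'a) \<Rightarrow> bool" where
  "bounded_operator N \<longleftrightarrow> (\<forall>S. bounded S \<longrightarrow> bounded (N ` S))"

definition demicontinuous :: "('a::complex_inner \<Rightarrow> 'a) \<Rightarrow> bool" where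
  "demicontinuous N \<longleftrightarrow>
     (\<forall>u u0. u \<longlonglongrightarrow> u0 \<longrightarrow> weakly_converges (\<lambda>k. N (u k)) (N u0))"

definition quasi_monotone :: "('a::complex_inner \<Rightarrow> 'a) \<Rightarrow> bool" where
  "quasi_monotone N \<longleftrightarrow> (\<forall>u u0. weakly_converges u u0 \<longrightarrow>
     limsup (\<lambda>k. ereal (Re (cinner (N (u k)) (u k - u0)))) \<ge> 0)"

end

theory Submission
  imports Defs
begin

text \<open>
  Because the essential spectrum of \<open>L\<close> starts at 0 and \<open>L\<close> is bounded below, only finitely
  many eigenvalues, each of finite multiplicity, lie below the gap \<open>(-\<delta>, 0)\<close>. So \<open>H = H\<^sub>1 \<oplus> H\<^sub>2\<close> with
  \<open>H\<^sub>1\<close> finite-dimensional, \<open>L\<close> negative definite on \<open>H\<^sub>1\<close>, and \<open>A = \<epsilon> P\<^sub>2 + L\<close> positive definite on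
  \<open>H\<^sub>2\<close>. Up to a change of sign on \<open>H\<^sub>1\<close> the operator \<open>A\<close> is coercive, and because \<open>N\<close> grows
  sublinearly, it dominates \<open>N\<close> far out. Hence the equation can be solved in finite-dimensional
  subspaces that exhaust the domain of \<open>A\<close>, by a Brouwer argument (\<open>finite_dim_zero\<close>), with
  bounded solutions.

  The weak limit \<open>x\<close> of these approximate solutions solves \<open>A x + z = h\<close>, where \<open>z\<close> is the weak limit
  of the values of \<open>N\<close>. Quasi-monotonicity alone does not give \<open>z = N x\<close>; but together with the
  strict positivity that \<open>\<epsilon>\<close> provides on \<open>H\<^sub>2\<close> and the finite dimension of \<open>H\<^sub>1\<close> it forces strong
  convergence of a subsequence, for which demicontinuity applies. This is
  \<open>saddle_equation_solvable\<close>, a statement on real Hilbert spaces; the complex structure matters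
  for the spectral hypotheses only.

  The spectral part derives the properties of \<open>A\<close> from the spectral family. Its key is that a band
  \<open>E\<^sub>b - E\<^sub>a\<close> of width \<open>w\<close> around \<open>z\<close> consists of vectors with \<open>norm (L k - z k) \<le> w norm k\<close>
  (\<open>band_norm_bound\<close>). Consequently the family is constant on the resolvent set, and near a
  point outside the essential spectrum it only moves within a finite-dimensional space.
\<close>

section \<open>Zeros of vector fields on finite-dimensional subspaces\<close>

text \<open>Brouwer's theorem on a cube, as a complementarity problem: each component of \<open>G\<close> vanishes at
  \<open>x\<close>, or \<open>x\<close> lies on one of the two faces for that coordinate and \<open>-G\<close> points out of the cube
  there. The dimension is a natural number and not a type, because it has to grow in the Galerkin
  scheme. Kuhn's lemma gives, on ever finer grids, small cells that carry both labels in each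
  coordinate; compactness of the cube then yields the point. Continuity is asked for along
  coordinatewise convergent sequences only.\<close>

lemma cube_complementarity:
  fixes G :: "(nat \<Rightarrow> real) \<Rightarrow> nat \<Rightarrow> real" and n :: nat and r :: real
  defines "Q \<equiv> {x. (\<forall>i<n. \<bar>x i\<bar> \<le> r) \<and> (\<forall>i\<ge>n. x i = 0)}"
  assumes "r > 0"
    and cont: "\<And>y x i. (\<And>k. y k \<in> Q) \<Longrightarrow> (\<And>j. (\<lambda>k::nat. y k j) \<longlonglongrightarrow> x j) \<Longrightarrow> i < n \<Longrightarrow>
                 (\<lambda>k. G (y k) i) \<longlonglongrightarrow> G x i"
  shows "\<exists>x\<in>Q. \<forall>i<n. G x i * x i \<le> 0 \<and> (\<bar>x i\<bar> < r \<longrightarrow> G x i = 0)"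
proof -
  \<comment> \<open>the grid of mesh \<open>2 * r / Suc m\<close>; label 0 records a nonpositive component or the lower face,
    label 1 a nonnegative component or the upper face\<close>
  define X where "X m q i = (if i < n then - r + 2 * r * real (q i) / real (Suc m) else 0)"
    for m :: nat and q :: "nat \<Rightarrow> nat" and i
  have XQ: "X m q \<in> Q" if "\<forall>i<n. q i \<le> Suc m" for m q
  proof -
    have "\<bar>X m q i\<bar> \<le> r" if "i < n" for i
    proof -
      have "real (q i) / real (Suc m) \<le> 1" "0 \<le> real (q i) / real (Suc m)"
        using \<open>\<forall>i<n. q i \<le> Suc m\<close> that by (auto simp: divide_le_eq)
      then have "r * (real (q i) / real (Suc m)) \<le> r * 1" "0 \<le> r * (real (q i) / real (Suc m))"
        using \<open>r > 0\<close> by (intro mult_left_mono mult_nonneg_nonneg; simp)+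
      then show ?thesis
        using that by (simp add: X_def abs_le_iff)
    qed
    then show ?thesis by (simp add: Q_def X_def)
  qed
  define lab where "lab m q i = (if q i = 0 then 0 else if q i = Suc m then 1
      else if G (X m q) i \<le> 0 then 0 else (1::nat))" for m :: nat and q :: "nat \<Rightarrow> nat" and i
  have lab0: "X m q i = - r \<or> G (X m q) i \<le> 0" if "lab m q i = 0" "i < n" for m q i
    using that by (auto simp: lab_def X_def split: if_splits)
  have lab1: "X m q i = r \<or> G (X m q) i \<ge> 0" if "lab m q i \<noteq> 0" "i < n" for m q i
    using that by (auto simp: lab_def X_def split: if_splits)
  \<comment> \<open>near \<open>q\<close>, \<open>s i\<close> and \<open>t i\<close> are grid points with different labels in coordinate \<open>i\<close>\<close>
  define adj where "adj m q w \<longleftrightarrow> (\<forall>j<n. w j \<le> Suc m \<and> \<bar>real (w j) - real (q j)\<bar> \<le> 1)"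
    for m and q w :: "nat \<Rightarrow> nat"
  define good where "good m q s t \<longleftrightarrow> (\<forall>i<n. q i \<le> Suc m \<and> adj m q (s i) \<and> adj m q (t i) \<and>
      lab m (s i) i = 0 \<and> lab m (t i) i \<noteq> 0)" for m and q and s t :: "nat \<Rightarrow> nat \<Rightarrow> nat"
  have "\<exists>q s t. good m q s t" for m
  proof -
    obtain q where q: "\<forall>i<n. q i < Suc m"
      and st: "\<forall>i<n. \<exists>s t. (\<forall>j<n. q j \<le> s j \<and> s j \<le> q j + 1) \<and>
        (\<forall>j<n. q j \<le> t j \<and> t j \<le> q j + 1) \<and> lab m s i \<noteq> lab m t i"
      by (rule kuhn_lemma[of "Suc m" n "lab m"]) (auto simp: lab_def)
    have "\<exists>s t. adj m q s \<and> adj m q t \<and> lab m s i = 0 \<and> lab m t i \<noteq> 0" if i: "i < n" for i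
    proof -
      obtain s t where s: "\<forall>j<n. q j \<le> s j \<and> s j \<le> q j + 1"
        and t: "\<forall>j<n. q j \<le> t j \<and> t j \<le> q j + 1" and ne: "lab m s i \<noteq> lab m t i"
        using st i by blast
      have *: "adj m q w" if "\<forall>j<n. q j \<le> w j \<and> w j \<le> q j + 1" for w
        unfolding adj_def
      proof (intro allI impI)
        fix j assume "j < n"
        then have "q j \<le> w j" "w j \<le> q j + 1" "q j < Suc m" using that q by auto
        then show "w j \<le> Suc m \<and> \<bar>real (w j) - real (q j)\<bar> \<le> 1" by linarith
      qed
      have lab01: "lab m w i = 0 \<or> lab m w i = 1" for w by (simp add: lab_def)
      have "lab m s i = 0 \<and> lab m t i \<noteq> 0 \<or> lab m t i = 0 \<and> lab m s i \<noteq> 0"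
        using ne lab01[of s] lab01[of t] by auto
      then show ?thesis using *[OF s] *[OF t] by blast
    qed
    then obtain s t where "\<forall>i<n. adj m q (s i) \<and> adj m q (t i) \<and> lab m (s i) i = 0 \<and> lab m (t i) i \<noteq> 0"
      by metis
    then have "good m q s t" using q less_imp_le unfolding good_def by blast
    then show ?thesis by blast
  qed
  then obtain q s t where "\<And>m. good m (q m) (s m) (t m)"
    by metis
  then have q: "\<And>m i. i < n \<Longrightarrow> q m i \<le> Suc m"
    and s: "\<And>m i j. i < n \<Longrightarrow> j < n \<Longrightarrow> s m i j \<le> Suc m \<and> \<bar>real (s m i j) - real (q m j)\<bar> \<le> 1"
    and t: "\<And>m i j. i < n \<Longrightarrow> j < n \<Longrightarrow> t m i j \<le> Suc m \<and> \<bar>real (t m i j) - real (q m j)\<bar> \<le> 1"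
    and s0: "\<And>m i. i < n \<Longrightarrow> lab m (s m i) i = 0"
    and t1: "\<And>m i. i < n \<Longrightarrow> lab m (t m i) i \<noteq> 0"
    unfolding good_def adj_def by blast+
  have "compact Q"
  proof -
    have "Q = PiE UNIV (\<lambda>i. if i < n then {-r..r} else {0})"
    proof -
      have ab: "\<bar>a\<bar> \<le> r \<longleftrightarrow> a \<in> {-r..r}" for a :: real by auto
      show ?thesis
        unfolding Q_def ab
        by (auto simp: PiE_def Pi_def not_less simp del: atLeastAtMost_iff)
    qed
    moreover have "compactin (product_topology (\<lambda>i::nat. euclideanreal) UNIV)
        (PiE UNIV (\<lambda>i. if i < n then {-r..r} else {0}))"
      by (subst compactin_PiE) auto
    ultimately show ?thesis
      by (simp add: euclidean_product_topology)
  qed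
  then have "seq_compact Q" by (simp add: compact_eq_seq_compact_metric)
  moreover have "X m (q m) \<in> Q" for m using q by (intro XQ) auto
  ultimately obtain x \<phi> where x: "x \<in> Q" and \<phi>: "strict_mono \<phi>"
      "((\<lambda>m. X m (q m)) \<circ> \<phi>) \<longlonglongrightarrow> x"
    unfolding seq_compact_def by metis
  have coord: "(\<lambda>m. X (\<phi> m) (q (\<phi> m)) j) \<longlonglongrightarrow> x j" for j
    using continuous_on_tendsto_compose[OF continuous_on_product_coordinates[of j] \<phi>(2)]
    by (simp add: o_def)
  \<comment> \<open>the cells shrink, so all corners converge to the limit of the base corners\<close>
  have near: "(\<lambda>m. X (\<phi> m) (w (\<phi> m)) j) \<longlonglongrightarrow> x j"
    if w: "\<And>m j. j < n \<Longrightarrow> \<bar>real (w m j) - real (q m j)\<bar> \<le> 1" for w j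
  proof -
    have "\<bar>X m (w m) j - X m (q m) j\<bar> \<le> 2 * r * inverse (real (Suc m))" for m
    proof (cases "j < n")
      case True
      have "X m (w m) j - X m (q m) j = 2 * r * (real (w m j) - real (q m j)) * inverse (real (Suc m))"
        using True by (simp add: X_def divide_inverse right_diff_distrib left_diff_distrib del: of_nat_Suc)
      then have "\<bar>X m (w m) j - X m (q m) j\<bar>
          = 2 * r * \<bar>real (w m j) - real (q m j)\<bar> * inverse (real (Suc m))"
        using \<open>r > 0\<close> by (simp add: abs_mult)
      also have "\<dots> \<le> 2 * r * 1 * inverse (real (Suc m))"
        using w[OF True, of m] \<open>r > 0\<close> by (intro mult_left_mono mult_right_mono) auto
      finally show ?thesis by simp
    qed (use \<open>r > 0\<close> in \<open>simp add: X_def\<close>)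
    moreover have "(\<lambda>m. 2 * r * inverse (real (Suc m))) \<longlonglongrightarrow> 2 * r * 0"
      by (intro tendsto_intros LIMSEQ_inverse_real_of_nat)
    ultimately have "(\<lambda>m. X m (w m) j - X m (q m) j) \<longlonglongrightarrow> 0"
      by (intro Lim_null_comparison[of "\<lambda>m. X m (w m) j - X m (q m) j" "\<lambda>m. 2 * r * inverse (real (Suc m))"])
         (auto intro: always_eventually)
    from tendsto_add[OF LIMSEQ_subseq_LIMSEQ[OF this \<phi>(1)] coord[of j]]
    show ?thesis by (simp add: o_def)
  qed
  have "x i = - r \<or> G x i \<le> 0" if i: "i < n" for i
  proof (rule disjCI)
    let ?y = "\<lambda>m. X (\<phi> m) (s (\<phi> m) i)"
    assume "\<not> G x i \<le> 0"
    have lim: "(\<lambda>m. ?y m j) \<longlonglongrightarrow> x j" for j using near[of "\<lambda>m. s m i"] s i by auto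
    have "(\<lambda>m. G (?y m) i) \<longlonglongrightarrow> G x i"
      using s i by (intro cont lim XQ) auto
    then have "\<forall>\<^sub>F m in sequentially. G (?y m) i > 0"
      using \<open>\<not> G x i \<le> 0\<close> by (intro order_tendstoD) auto
    then have "\<forall>\<^sub>F m in sequentially. ?y m i = - r"
    proof eventually_elim
      case (elim m)
      then show ?case using lab0[OF s0[OF i, of "\<phi> m"] i] by auto
    qed
    then show "x i = - r"
      by (rule LIMSEQ_unique[OF lim tendsto_eventually])
  qed
  moreover have "x i = r \<or> G x i \<ge> 0" if i: "i < n" for i
  proof (rule disjCI)
    let ?y = "\<lambda>m. X (\<phi> m) (t (\<phi> m) i)"
    assume "\<not> G x i \<ge> 0"
    have lim: "(\<lambda>m. ?y m j) \<longlonglongrightarrow> x j" for j using near[of "\<lambda>m. t m i"] t i by auto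
    have "(\<lambda>m. G (?y m) i) \<longlonglongrightarrow> G x i"
      using t i by (intro cont lim XQ) auto
    then have "\<forall>\<^sub>F m in sequentially. G (?y m) i < 0"
      using \<open>\<not> G x i \<ge> 0\<close> by (intro order_tendstoD) auto
    then have "\<forall>\<^sub>F m in sequentially. ?y m i = r"
    proof eventually_elim
      case (elim m)
      then show ?case using lab1[OF t1[OF i, of "\<phi> m"] i] by auto
    qed
    then show "x i = r"
      by (rule LIMSEQ_unique[OF lim tendsto_eventually])
  qed
  ultimately have "G x i * x i \<le> 0 \<and> (\<bar>x i\<bar> < r \<longrightarrow> G x i = 0)" if "i < n" for i
    using \<open>r > 0\<close> that by (smt (verit) mult_nonneg_nonpos mult_nonpos_nonneg)
  with x show ?thesis by blast
qed

lemma orthonormal_basis_exists: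
  fixes B :: "'a::real_inner set"
  assumes "finite B"
  shows "\<exists>C. finite C \<and> span C = span B \<and> (\<forall>c\<in>C. norm c = 1) \<and> pairwise orthogonal C"
  using assms
proof (induction B)
  case empty
  then show ?case by (intro exI[of _ "{}"]) auto
next
  case (insert b B)
  then obtain C where C: "finite C" "span C = span B" "\<forall>c\<in>C. norm c = 1" "pairwise orthogonal C"
    by blast
  define p where "p = (\<Sum>c\<in>C. (b \<bullet> c) *\<^sub>R c)"
  have p: "p \<in> span C" unfolding p_def by (intro span_sum span_scale span_base)
  have orth: "(b - p) \<bullet> c = 0" if "c \<in> C" for c
  proof -
    have "p \<bullet> c = (\<Sum>d\<in>C. if d = c then b \<bullet> c else 0)"
      unfolding p_def inner_sum_left using C that
      by (intro sum.cong) (auto simp: pairwise_def orthogonal_def dot_square_norm)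
    then show ?thesis using C(1) that by (simp add: inner_diff_left)
  qed
  have sp: "span (insert b B) = span (insert (b - p) C)"
  proof -
    have "span (insert b C) = span (insert (b - p) C)"
      using eq_span_insert_eq[of b "b - p" C] p by simp
    then show ?thesis using C(2) by (simp add: span_insert)
  qed
  show ?case
  proof (cases "b = p")
    case True
    then show ?thesis using C sp by (intro exI[of _ C]) (simp add: span_insert_0)
  next
    case False
    define e where "e = (1 / norm (b - p)) *\<^sub>R (b - p)"
    have "span (insert e C) = span (insert (b - p) C)"
    proof (rule antisym; rule span_minimal)
      have "(b - p) = norm (b - p) *\<^sub>R e" using False by (simp add: e_def)
      then have "b - p \<in> span (insert e C)" by (metis insertI1 span_base span_scale)
      then show "insert (b - p) C \<subseteq> span (insert e C)" by (auto intro: span_base)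
      show "insert e C \<subseteq> span (insert (b - p) C)"
        by (auto simp: e_def intro: span_base span_scale)
    qed auto
    moreover have "norm e = 1" using False by (simp add: e_def)
    moreover have "orthogonal e c" "orthogonal c e" if "c \<in> C" for c
      using orth[OF that] by (simp_all add: orthogonal_def e_def inner_commute)
    ultimately show ?thesis
      using C sp by (intro exI[of _ "insert e C"]) (auto simp: pairwise_insert)
  qed
qed

text \<open>A field that points outwards on and outside a sphere has a zero inside. In orthonormal
  coordinates the complementarity point \<open>x\<close> satisfies \<open>F x \<bullet> x \<le> 0\<close>, hence lies inside the sphere
  of radius \<open>r\<close>; then all its coordinates are smaller than \<open>r\<close>, it is interior to the cube, and
  every component of the field vanishes there.\<close>

lemma finite_dim_zero:
  fixes F :: "'a::real_inner \<Rightarrow> 'a"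
  assumes "finite B" "r > 0"
    and cont: "\<And>u x v. (\<And>k. u k \<in> span B) \<Longrightarrow> u \<longlonglongrightarrow> x \<Longrightarrow> x \<in> span B \<Longrightarrow> v \<in> span B \<Longrightarrow>
                 (\<lambda>k::nat. F (u k) \<bullet> v) \<longlonglongrightarrow> F x \<bullet> v"
    and pos: "\<And>u. u \<in> span B \<Longrightarrow> norm u \<ge> r \<Longrightarrow> F u \<bullet> u > 0"
  shows "\<exists>u\<in>span B. norm u < r \<and> (\<forall>v\<in>span B. F u \<bullet> v = 0)"
proof -
  obtain C where C: "finite C" "span C = span B" "\<forall>c\<in>C. norm c = 1" "pairwise orthogonal C"
    using orthonormal_basis_exists[OF \<open>finite B\<close>] by blast
  obtain e n where e: "bij_betw e {..<n::nat} C"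
    using ex_bij_betw_nat_finite[OF C(1)] by (auto simp: atLeast0LessThan)
  have eC: "e i \<in> C" if "i < n" for i using e that by (auto simp: bij_betw_def)
  define \<psi> where "\<psi> x = (\<Sum>i<n. x i *\<^sub>R e i)" for x :: "nat \<Rightarrow> real"
  have \<psi>V: "\<psi> x \<in> span B" for x
    unfolding \<psi>_def C(2)[symmetric] by (intro span_sum span_scale span_base) (use eC in auto)
  have eV: "e i \<in> span B" if "i < n" for i using eC[OF that] C(2) span_base by blast
  have \<psi>e: "\<psi> x \<bullet> e i = x i" if "i < n" for x i
  proof -
    have "\<psi> x \<bullet> e i = (\<Sum>j<n. if j = i then x i else 0)"
      unfolding \<psi>_def inner_sum_left
    proof (intro sum.cong refl)
      fix j assume j: "j \<in> {..<n}"
      show "x j *\<^sub>R e j \<bullet> e i = (if j = i then x i else 0)"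
      proof (cases "j = i")
        case True
        then show ?thesis using C(3) eC[OF that] by (simp add: dot_square_norm)
      next
        case False
        then have "e j \<noteq> e i" using e j that by (auto simp: bij_betw_def inj_on_def)
        then show ?thesis using C(4) eC j that False by (auto simp: pairwise_def orthogonal_def)
      qed
    qed
    then show ?thesis using that by simp
  qed
  let ?Q = "{x. (\<forall>i<n. \<bar>x i\<bar> \<le> r) \<and> (\<forall>i\<ge>n. x i = 0)}"
  have "\<exists>x\<in>?Q. \<forall>i<n. F (\<psi> x) \<bullet> e i * x i \<le> 0 \<and> (\<bar>x i\<bar> < r \<longrightarrow> F (\<psi> x) \<bullet> e i = 0)"
  proof (rule cube_complementarity[where G = "\<lambda>x i. F (\<psi> x) \<bullet> e i", OF \<open>r > 0\<close>])
    fix y :: "nat \<Rightarrow> nat \<Rightarrow> real" and x i assume lim: "\<And>j. (\<lambda>k::nat. y k j) \<longlonglongrightarrow> x j" and i: "i < n"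
    have "(\<lambda>k. \<psi> (y k)) \<longlonglongrightarrow> \<psi> x"
      unfolding \<psi>_def by (intro tendsto_sum tendsto_scaleR lim tendsto_const)
    then show "(\<lambda>k. F (\<psi> (y k)) \<bullet> e i) \<longlonglongrightarrow> F (\<psi> x) \<bullet> e i"
      by (intro cont \<psi>V eV i)
  qed
  then obtain x where x: "\<And>i. i < n \<Longrightarrow> F (\<psi> x) \<bullet> e i * x i \<le> 0"
      "\<And>i. i < n \<Longrightarrow> \<bar>x i\<bar> < r \<Longrightarrow> F (\<psi> x) \<bullet> e i = 0"
    by blast
  have "F (\<psi> x) \<bullet> \<psi> x = (\<Sum>i<n. F (\<psi> x) \<bullet> e i * x i)"
    by (subst (2) \<psi>_def) (simp add: inner_sum_right mult.commute)
  also have "\<dots> \<le> 0" by (intro sum_nonpos) (use x in auto)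
  finally have small: "norm (\<psi> x) < r" using pos[OF \<psi>V, of x] by force
  have zero: "F (\<psi> x) \<bullet> e i = 0" if "i < n" for i
  proof (rule x(2)[OF that])
    have "\<bar>x i\<bar> \<le> norm (\<psi> x) * norm (e i)"
      using Cauchy_Schwarz_ineq2[of "\<psi> x" "e i"] \<psi>e[OF that] by simp
    then show "\<bar>x i\<bar> < r" using small C(3) eC[OF that] by simp
  qed
  have "F (\<psi> x) \<bullet> v = 0" if "v \<in> span B" for v
  proof -
    have "span C \<subseteq> {v. F (\<psi> x) \<bullet> v = 0}"
    proof (rule span_minimal)
      show "C \<subseteq> {v. F (\<psi> x) \<bullet> v = 0}" using zero e by (auto simp: bij_betw_def)
    qed (auto simp: subspace_def inner_add_right)
    then show ?thesis using that C(2) by auto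
  qed
  with small \<psi>V show ?thesis by blast
qed

section \<open>Weak sequential compactness\<close>

text \<open>The representing vector is the minimizer of \<open>x \<bullet> x - 2 * f x\<close>. By the parallelogram law every
  minimizing sequence is Cauchy, and the first variation at the minimum is the claim.\<close>

lemma riesz_representation:
  fixes f :: "'a::{real_inner,complete_space} \<Rightarrow> real"
  assumes "bounded_linear f"
  shows "\<exists>u. \<forall>v. f v = u \<bullet> v"
proof -
  interpret bounded_linear f by fact
  obtain C where C: "\<And>x. \<bar>f x\<bar> \<le> norm x * C"
    using bounded by auto
  define J where "J x = x \<bullet> x - 2 * f x" for x
  have lower: "- (C\<^sup>2) \<le> J x" for x
  proof -
    have "0 \<le> (norm x - C)\<^sup>2" by simp
    then have "2 * (norm x * C) \<le> (norm x)\<^sup>2 + C\<^sup>2" by (simp add: power2_diff)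
    then show ?thesis using C[of x] by (simp add: J_def dot_square_norm abs_le_iff)
  qed
  define m where "m = Inf (range J)"
  have bb: "bdd_below (range J)" using lower by (auto intro!: bdd_belowI)
  have mle: "m \<le> J x" for x unfolding m_def by (intro cInf_lower bb) auto
  have "\<exists>x. J x < m + 1 / real (Suc n)" for n
  proof -
    have "Inf (range J) < m + 1 / real (Suc n)" by (simp add: m_def)
    then show ?thesis using cInf_less_iff[OF _ bb] by auto
  qed
  then obtain x where x: "\<And>n. J (x n) < m + 1 / real (Suc n)" by metis
  \<comment> \<open>the parallelogram law, with the midpoint estimated by the infimum\<close>
  have par: "(norm (y - z))\<^sup>2 \<le> 2 * (J y - m) + 2 * (J z - m)" for y z
  proof -
    have "4 * J ((1/2) *\<^sub>R (y + z)) = (y + z) \<bullet> (y + z) - 4 * f y - 4 * f z"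
      by (simp add: J_def scaleR add inner_simps algebra_simps)
    moreover have "(norm (y - z))\<^sup>2 = 2 * (y \<bullet> y) + 2 * (z \<bullet> z) - (y + z) \<bullet> (y + z)"
      by (simp add: power2_norm_eq_inner inner_simps inner_commute algebra_simps)
    ultimately show ?thesis using mle[of "(1/2) *\<^sub>R (y + z)"] by (simp add: J_def)
  qed
  have "Cauchy x"
  proof (rule metric_CauchyI)
    fix e :: real assume "e > 0"
    obtain k where k: "inverse (real (Suc k)) < e\<^sup>2 / 4"
      using reals_Archimedean[of "e\<^sup>2 / 4"] \<open>e > 0\<close> by auto
    have "dist (x i) (x j) < e" if "i \<ge> k" "j \<ge> k" for i j
    proof -
      have *: "J (x l) - m < e\<^sup>2 / 4" if "l \<ge> k" for l
      proof -
        have "1 / real (Suc l) \<le> inverse (real (Suc k))" using that by (simp add: field_simps)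
        then show ?thesis using x[of l] k by linarith
      qed
      have "(dist (x i) (x j))\<^sup>2 < e\<^sup>2"
        using par[of "x i" "x j"] *[OF that(1)] *[OF that(2)] by (simp add: dist_norm)
      then show ?thesis using \<open>e > 0\<close> by (simp add: power_less_imp_less_base)
    qed
    then show "\<exists>M. \<forall>i\<ge>M. \<forall>j\<ge>M. dist (x i) (x j) < e" by blast
  qed
  then obtain u where u: "x \<longlonglongrightarrow> u" using Cauchy_convergent convergent_def by blast
  have "(\<lambda>n. J (x n)) \<longlonglongrightarrow> J u"
    unfolding J_def by (intro tendsto_intros u tendsto)
  moreover have "(\<lambda>n. m + 1 / real (Suc n)) \<longlonglongrightarrow> m + 0"
    using LIMSEQ_inverse_real_of_nat by (intro tendsto_intros) (simp add: divide_inverse)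
  ultimately have "J u \<le> m + 0"
    using x less_imp_le by (intro LIMSEQ_le[of "\<lambda>n. J (x n)" _ "\<lambda>n. m + 1 / real (Suc n)"]) blast+
  then have min: "J u \<le> J y" for y using mle[of y] by simp
  have "f v = u \<bullet> v" for v
  proof (cases "v = 0")
    case False
    define a where "a = u \<bullet> v - f v"
    have "J (u + t *\<^sub>R v) = J u + 2 * t * a + t\<^sup>2 * (v \<bullet> v)" for t
      by (simp add: J_def a_def add scaleR inner_simps inner_commute power2_eq_square algebra_simps)
    then have "0 \<le> 2 * t * a + t\<^sup>2 * (v \<bullet> v)" for t using min[of "u + t *\<^sub>R v"] by simp
    from this[of "- a / (v \<bullet> v)"] have "0 \<le> - (a\<^sup>2 / (v \<bullet> v))"
      using False by (simp add: power2_eq_square field_simps)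
    moreover have "v \<bullet> v > 0" using False by simp
    ultimately have "a\<^sup>2 \<le> 0"
      by (metis divide_le_0_iff neg_0_le_iff_le not_less zero_le_power2 order.antisym)
    then show ?thesis by (simp add: a_def)
  qed (simp add: zero)
  then show ?thesis by blast
qed

text \<open>Testing with a countable dense set embeds the sequence in a countable product of compact
  intervals, where it has a convergent subsequence. By density and boundedness the scalar products
  with every vector converge, and their limit is a bounded functional, to be represented by
  Riesz.\<close>

lemma weak_sequential_compactness:
  fixes u :: "nat \<Rightarrow> 'a::{real_inner,complete_space}" and X :: "'a set"
  assumes X: "countable X" "closure X = UNIV" and bnd: "\<And>n. norm (u n) \<le> R"
  shows "\<exists>\<phi> x. strict_mono \<phi> \<and> (\<forall>v. (\<lambda>n. u (\<phi> n) \<bullet> v) \<longlonglongrightarrow> x \<bullet> v)"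
proof -
  have "X \<noteq> {}" using X(2) by auto
  then obtain d :: "nat \<Rightarrow> 'a" where d: "range d = X"
    using X(1) by (metis uncountable_def)
  define c where "c n k = u n \<bullet> d k" for n k
  have "compact (PiE UNIV (\<lambda>k::nat. {- (R * norm (d k))..R * norm (d k)}))"
  proof -
    have "compactin (product_topology (\<lambda>i::nat. euclideanreal) UNIV)
        (PiE UNIV (\<lambda>k::nat. {- (R * norm (d k))..R * norm (d k)}))"
      by (subst compactin_PiE) auto
    then show ?thesis by (simp add: euclidean_product_topology)
  qed
  then have "seq_compact (PiE UNIV (\<lambda>k::nat. {- (R * norm (d k))..R * norm (d k)}))"
    by (simp add: compact_eq_seq_compact_metric)
  moreover have "c n \<in> PiE UNIV (\<lambda>k::nat. {- (R * norm (d k))..R * norm (d k)})" for n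
  proof -
    have "- (R * norm (d k)) \<le> u n \<bullet> d k \<and> u n \<bullet> d k \<le> R * norm (d k)" for k
      using Cauchy_Schwarz_ineq2[of "u n" "d k"] mult_right_mono[OF bnd[of n] norm_ge_zero[of "d k"]]
      by linarith
    then show ?thesis by (simp add: PiE_def Pi_def c_def)
  qed
  ultimately obtain l \<phi> where \<phi>: "strict_mono \<phi>" "(c \<circ> \<phi>) \<longlonglongrightarrow> l"
    unfolding seq_compact_def by metis
  have conv_d: "(\<lambda>n. u (\<phi> n) \<bullet> d k) \<longlonglongrightarrow> l k" for k
    using continuous_on_tendsto_compose[OF continuous_on_product_coordinates[of k] \<phi>(2)]
    by (simp add: o_def c_def)
  have R: "R \<ge> 0" using bnd[of 0] norm_ge_zero order_trans by blast
  have "convergent (\<lambda>n. u (\<phi> n) \<bullet> v)" for v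
  proof (rule Cauchy_convergent, rule metric_CauchyI)
    fix e :: real assume "e > 0"
    have "v \<in> closure X" using X(2) by simp
    moreover have "e / (3 * (R + 1)) > 0" using \<open>e > 0\<close> R by simp
    ultimately obtain k where k: "dist (d k) v < e / (3 * (R + 1))"
      unfolding closure_approachable d[symmetric] by blast
    have close: "\<bar>u n \<bullet> v - u n \<bullet> d k\<bar> < e / 3" for n
    proof -
      have "\<bar>u n \<bullet> v - u n \<bullet> d k\<bar> \<le> norm (u n) * dist (d k) v"
        using Cauchy_Schwarz_ineq2[of "u n" "v - d k"]
        by (simp add: inner_diff_right dist_norm norm_minus_commute)
      also have "\<dots> \<le> (R + 1) * dist (d k) v"
        using bnd[of n] by (intro mult_right_mono) auto
      also have "\<dots> < (R + 1) * (e / (3 * (R + 1)))"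
        using k R by (intro mult_strict_left_mono) auto
      also have "\<dots> = e / 3"
      proof -
        have *: "K * (e / (3 * K)) = e / 3" if "K > 0" for K :: real using that by simp
        have "R + 1 > 0" using R by simp
        then show ?thesis by (rule *)
      qed
      finally show ?thesis .
    qed
    have "Cauchy (\<lambda>n. u (\<phi> n) \<bullet> d k)"
      using conv_d convergent_Cauchy convergent_def by blast
    then obtain M where M: "\<And>i j. i \<ge> M \<Longrightarrow> j \<ge> M \<Longrightarrow> dist (u (\<phi> i) \<bullet> d k) (u (\<phi> j) \<bullet> d k) < e / 3"
      using \<open>e > 0\<close> metric_CauchyD[of "\<lambda>n. u (\<phi> n) \<bullet> d k" "e / 3"] by (metis zero_less_divide_iff zero_less_numeral)
    have "dist (u (\<phi> i) \<bullet> v) (u (\<phi> j) \<bullet> v) < e" if "i \<ge> M" "j \<ge> M" for i j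
    proof -
      have "\<bar>u (\<phi> i) \<bullet> d k - u (\<phi> j) \<bullet> d k\<bar> < e / 3"
        using M that by (simp add: dist_real_def)
      then show ?thesis
        using close[of "\<phi> i"] close[of "\<phi> j"] unfolding dist_real_def by linarith
    qed
    then show "\<exists>M. \<forall>i\<ge>M. \<forall>j\<ge>M. dist (u (\<phi> i) \<bullet> v) (u (\<phi> j) \<bullet> v) < e" by blast
  qed
  then obtain f where f: "\<And>v. (\<lambda>n. u (\<phi> n) \<bullet> v) \<longlonglongrightarrow> f v"
    unfolding convergent_def by metis
  have "bounded_linear f"
  proof (rule bounded_linear_intro[of _ R])
    fix v w :: 'a and r :: real
    have "(\<lambda>n. u (\<phi> n) \<bullet> (v + w)) \<longlonglongrightarrow> f v + f w"
      using tendsto_add[OF f f] by (simp add: inner_add_right)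
    then show "f (v + w) = f v + f w" using LIMSEQ_unique[OF f] by blast
    have "(\<lambda>n. u (\<phi> n) \<bullet> (r *\<^sub>R v)) \<longlonglongrightarrow> r * f v"
      using tendsto_mult_left[OF f] by simp
    then show "f (r *\<^sub>R v) = r *\<^sub>R f v" using LIMSEQ_unique[OF f] by simp
    have "\<bar>u (\<phi> n) \<bullet> v\<bar> \<le> norm v * R" for n
      using Cauchy_Schwarz_ineq2[of "u (\<phi> n)" v] mult_right_mono[OF bnd[of "\<phi> n"] norm_ge_zero[of v]]
      by (simp add: mult.commute)
    moreover have "(\<lambda>n. \<bar>u (\<phi> n) \<bullet> v\<bar>) \<longlonglongrightarrow> \<bar>f v\<bar>" by (intro tendsto_rabs f)
    ultimately show "norm (f v) \<le> norm v * R"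
      unfolding real_norm_def by (intro LIMSEQ_le_const2) auto
  qed
  then obtain x where "\<forall>v. f v = x \<bullet> v" using riesz_representation by blast
  with f \<phi>(1) show ?thesis by force
qed

text \<open>The graph is a subset of a separable metric space and therefore separable. Galerkin spaces built
  from this sequence exhaust the domain in the graph norm, which is what lets an equation tested
  on these spaces be tested on the whole domain.\<close>

lemma countable_dense_in_graph:
  fixes A :: "'a::metric_space \<Rightarrow> 'a" and S D :: "'a set"
  assumes S: "countable S" "closure S = UNIV" and "D \<noteq> {}"
  obtains d :: "nat \<Rightarrow> 'a" where "\<And>n. d n \<in> D"
    and "\<And>x e. x \<in> D \<Longrightarrow> e > 0 \<Longrightarrow> \<exists>n. dist (d n) x < e \<and> dist (A (d n)) (A x) < e"
proof -
  define ok where "ok p x \<longleftrightarrow> (case p of (s, t, n) \<Rightarrow>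
      x \<in> D \<and> dist s x < inverse (real (Suc n)) \<and> dist t (A x) < inverse (real (Suc n)))" for p x
  define I where "I = {p \<in> S \<times> S \<times> UNIV. \<exists>x. ok p x}"
  have ex: "\<exists>p\<in>I. ok p x \<and> snd (snd p) = n" if "x \<in> D" for x n
  proof -
    have "x \<in> closure S" "A x \<in> closure S" using S by auto
    then obtain s t where "s \<in> S" "t \<in> S" "dist s x < inverse (real (Suc n))" "dist t (A x) < inverse (real (Suc n))"
      unfolding closure_approachable by (meson inverse_positive_iff_positive of_nat_0_less_iff zero_less_Suc)
    then show ?thesis using that by (intro bexI[of _ "(s, t, n)"]) (auto simp: ok_def I_def)
  qed
  have "countable I"
    unfolding I_def by (rule countable_subset[of _ "S \<times> S \<times> UNIV"]) (use S in auto)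
  moreover have "I \<noteq> {}" using ex \<open>D \<noteq> {}\<close> by blast
  ultimately obtain f :: "nat \<Rightarrow> _" where f: "range f = I" by (metis uncountable_def)
  define d where "d n = (SOME x. ok (f n) x)" for n
  have d: "ok (f n) (d n)" for n
  proof -
    have "f n \<in> I" using f by blast
    then show ?thesis unfolding d_def I_def by (auto intro: someI)
  qed
  show thesis
  proof
    show "d n \<in> D" for n using d[of n] by (auto simp: ok_def split: prod.splits)
    fix x and e :: real assume x: "x \<in> D" and "e > 0"
    obtain k where k: "inverse (real (Suc k)) < e / 2" using reals_Archimedean[of "e / 2"] \<open>e > 0\<close> by auto
    obtain p where p: "p \<in> I" "ok p x" "snd (snd p) = k" using ex[OF x] by blast
    obtain n where n: "f n = p" using f p(1) by blast
    obtain s t where st: "p = (s, t, k)" using p(3) by (metis prod.collapse)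
    have "dist s x < e / 2" "dist t (A x) < e / 2" "dist s (d n) < e / 2" "dist t (A (d n)) < e / 2"
      using p(2) d[of n] k unfolding n st ok_def by auto
    then show "\<exists>n. dist (d n) x < e \<and> dist (A (d n)) (A x) < e"
      using dist_triangle3[of "d n" x s] dist_triangle3[of "A (d n)" "A x" t] by (intro exI[of _ n]) auto
  qed
qed

section \<open>Equations with an indefinite coercive linear part\<close>

lemma sublinear_bound:
  fixes N :: "'a::real_normed_vector \<Rightarrow> 'a"
  assumes sub: "\<And>u::nat \<Rightarrow> 'a. filterlim (\<lambda>k. norm (u k)) at_top sequentially \<Longrightarrow>
           (\<lambda>k. norm (N (u k)) / norm (u k)) \<longlonglongrightarrow> 0"
    and "c > 0"
  shows "\<exists>r>0. \<forall>u. norm u \<ge> r \<longrightarrow> norm (N u) \<le> c * norm u"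
proof (rule ccontr)
  assume "\<not> ?thesis"
  then have "\<exists>u. norm u \<ge> real (Suc k) \<and> norm (N u) > c * norm u" for k
    by (metis not_less of_nat_0_less_iff zero_less_Suc)
  then obtain u where u: "\<And>k. norm (u k) \<ge> real (Suc k)" "\<And>k. norm (N (u k)) > c * norm (u k)"
    by metis
  have "filterlim (\<lambda>k. norm (u k)) at_top sequentially"
  proof (rule filterlim_at_top_mono)
    show "filterlim (\<lambda>k. real (Suc k)) at_top sequentially"
      by (rule filterlim_compose[OF filterlim_real_sequentially filterlim_Suc])
  qed (use u in auto)
  from order_tendstoD(2)[OF sub[OF this] \<open>c > 0\<close>]
  have "\<exists>k. norm (N (u k)) / norm (u k) < c"
    unfolding eventually_sequentially by blast
  then obtain k where k: "norm (N (u k)) / norm (u k) < c" by blast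
  have "norm (u k) > 0" using u(1)[of k] of_nat_0_less_iff[of "Suc k"] by linarith
  then show False using k u(2)[of k] by (simp add: divide_less_eq)
qed


text \<open>The linear part \<open>A\<close> is symmetric and as large as its symmetry permits, hence self-adjoint; it is
  negative definite on the finite-dimensional range of \<open>P\<close> and positive definite on the kernel.
  The reflection \<open>J x = x - 2 P x\<close> turns this into coercivity, \<open>A x \<bullet> J x \<ge> c (norm x)^2\<close>, and since
  \<open>N\<close> is sublinear the field \<open>J (A x + N x - h)\<close> points outwards on a large sphere. The Galerkin
  spaces contain the range of \<open>P\<close>, so that \<open>J\<close> maps them to themselves and each of them contains a
  solution \<open>u n\<close> of the projected equation, with a common bound.

  Let \<open>u n\<close> and \<open>N (u n)\<close> converge weakly to \<open>x\<close> and \<open>z\<close>. Passing to the limit in the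
  projected equations, maximality of \<open>A\<close> gives \<open>A x + z = h\<close>. It remains to see that \<open>N x = z\<close>.
  The equations show that \<open>A (u n - x) \<bullet> (u n - x) + N (u n) \<bullet> (u n - x)\<close> tends to 0. The component
  of \<open>u n - x\<close> in the range of \<open>P\<close> converges strongly because that range is finite-dimensional, so
  the first term is at least \<open>c (norm q)^2\<close> up to a null sequence, where \<open>q\<close> is the other component.
  Quasi-monotonicity says that the second term is almost nonnegative infinitely often; along
  these indices \<open>u n\<close> converges strongly, and demicontinuity identifies \<open>z\<close>.\<close>

lemma saddle_equation_solvable:
  fixes A N P :: "'a::{real_inner,complete_space} \<Rightarrow> 'a" and D B :: "'a set"
  assumes sep: "separable_space (euclidean :: 'a topology)"
    and D: "subspace D"
    and A_add: "\<And>x y. x \<in> D \<Longrightarrow> y \<in> D \<Longrightarrow> A (x + y) = A x + A y"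
    and A_scale: "\<And>r x. x \<in> D \<Longrightarrow> A (r *\<^sub>R x) = r *\<^sub>R A x"
    and A_sym: "\<And>x y. x \<in> D \<Longrightarrow> y \<in> D \<Longrightarrow> A x \<bullet> y = x \<bullet> A y"
    and A_max: "\<And>u w. (\<And>x. x \<in> D \<Longrightarrow> A x \<bullet> u = x \<bullet> w) \<Longrightarrow> u \<in> D \<and> A u = w"
    and P: "linear P" "\<And>x. P (P x) = P x" "\<And>x y. P x \<bullet> y = x \<bullet> P y"
    and B: "finite B" "range P \<subseteq> span B" "range P \<subseteq> D"
    and c: "c > 0"
    and neg: "\<And>x. A (P x) \<bullet> P x \<le> - c * (norm (P x))\<^sup>2"
    and pos: "\<And>x. x \<in> D \<Longrightarrow> P x = 0 \<Longrightarrow> A x \<bullet> x \<ge> c * (norm x)\<^sup>2"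
    and N_bnd: "\<And>S. bounded S \<Longrightarrow> bounded (N ` S)"
    and N_demi: "\<And>u x v. u \<longlonglongrightarrow> x \<Longrightarrow> (\<lambda>k::nat. N (u k) \<bullet> v) \<longlonglongrightarrow> N x \<bullet> v"
    and N_qm: "\<And>u x e k0. (\<And>v. (\<lambda>k::nat. u k \<bullet> v) \<longlonglongrightarrow> x \<bullet> v) \<Longrightarrow> e > 0 \<Longrightarrow>
                 \<exists>k\<ge>k0. N (u k) \<bullet> (u k - x) > - e"
    and N_sub: "\<And>u::nat \<Rightarrow> 'a. filterlim (\<lambda>k. norm (u k)) at_top sequentially \<Longrightarrow>
           (\<lambda>k. norm (N (u k)) / norm (u k)) \<longlonglongrightarrow> 0"
  shows "\<exists>u\<in>D. A u + N u = h"
proof -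
  interpret P: linear P by fact
  have A_0: "A 0 = 0" using A_scale[of 0 0] subspace_0[OF D] by simp
  have A_diff: "A (x - y) = A x - A y" if "x \<in> D" "y \<in> D" for x y
    using A_add[of x "- 1 *\<^sub>R y"] A_scale[of y "-1"] that subspace_neg[OF D] by simp
  have PD: "P x \<in> D" for x using B by blast
  have QD: "x - P x \<in> D" if "x \<in> D" for x using that PD subspace_diff[OF D] by blast
  have "\<exists>B0. finite B0 \<and> span B0 = range P"
  proof (intro exI conjI)
    show "finite (P ` B)" using B by simp
    have "P x \<in> span (P ` B)" for x
    proof -
      have "P (P x) \<in> P ` span B" using B by blast
      then show ?thesis by (simp add: P linear_span_image)
    qed
    moreover have "span (P ` B) \<subseteq> range P"
      by (rule span_minimal) (auto intro: linear_subspace_image P(1))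
    ultimately show "span (P ` B) = range P" by blast
  qed
  then obtain C where C: "finite C" "span C = range P" "\<forall>c\<in>C. norm c = 1" "pairwise orthogonal C"
    using orthonormal_basis_exists by metis
  have CD: "c \<in> D" if "c \<in> C" for c using that C(2) B(3) span_base by blast
  have expand: "P x = (\<Sum>c\<in>C. (x \<bullet> c) *\<^sub>R c)" for x
  proof -
    define p where "p = (\<Sum>c\<in>C. (x \<bullet> c) *\<^sub>R c)"
    have Pc: "P c = c" if "c \<in> C" for c
      using that C(2) P(2) span_base[of c C] by (metis rangeE)
    have "(P x - p) \<bullet> c = 0" if "c \<in> C" for c
    proof -
      have "p \<bullet> c = (\<Sum>d\<in>C. if d = c then x \<bullet> c else 0)"
        unfolding p_def inner_sum_left using C that
        by (intro sum.cong) (auto simp: pairwise_def orthogonal_def dot_square_norm)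
      then show ?thesis using C(1) that P(3)[of x c] Pc[OF that] by (simp add: inner_diff_left)
    qed
    then have "span C \<subseteq> {y. (P x - p) \<bullet> y = 0}"
      by (intro span_minimal) (auto simp: subspace_def inner_add_right)
    moreover have "P x - p \<in> span C"
    proof (rule span_diff)
      show "P x \<in> span C" using C(2) by blast
      show "p \<in> span C" unfolding p_def by (intro span_sum span_scale span_base)
    qed
    ultimately have "(P x - p) \<bullet> (P x - p) = 0" by blast
    then show ?thesis by (simp add: p_def)
  qed
  obtain S :: "'a set" where S: "countable S" "closure S = UNIV"
    using sep unfolding separable_space_def by auto
  obtain d where dD: "\<And>n::nat. d n \<in> D"
    and dense: "\<And>x e. x \<in> D \<Longrightarrow> e > 0 \<Longrightarrow> \<exists>n. dist (d n) x < e \<and> dist (A (d n)) (A x) < e"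
    using countable_dense_in_graph[OF S, of D A] subspace_0[OF D] by blast
  define V where "V n = span (C \<union> d ` {..n})" for n
  have finV: "finite (C \<union> d ` {..n})" for n using C(1) by simp
  have VD: "V n \<subseteq> D" for n
    unfolding V_def by (intro span_minimal D) (use CD dD in auto)
  have Vmono: "V m \<subseteq> V n" if "m \<le> n" for m n
    unfolding V_def using that by (intro span_mono) auto
  have PV: "P x \<in> V n" for x n
  proof -
    have "P x \<in> span C" using C(2) by blast
    then show ?thesis unfolding V_def using span_mono[of C "C \<union> d ` {..n}"] by blast
  qed
  have dV: "d m \<in> V n" if "m \<le> n" for m n
    unfolding V_def using that by (intro span_base) auto
  define J where "J x = x - 2 *\<^sub>R P x" for x
  have JV: "J x \<in> V n" if "x \<in> V n" for x n
    unfolding J_def using that PV[of x n] unfolding V_def by (intro span_diff span_scale)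
  have JJ: "J (J x) = x" for x by (simp add: J_def P.diff P.add P(2) scaleR_2)
  have J_sym: "J x \<bullet> y = x \<bullet> J y" for x y
    by (simp add: J_def inner_diff_left inner_diff_right P(3))
  have normJ: "norm (J x) = norm x" for x
    by (simp add: norm_eq_sqrt_inner J_sym JJ)
  \<comment> \<open>the mixed terms cancel because \<open>A\<close> is symmetric\<close>
  have coercive: "A x \<bullet> J x \<ge> c * (norm x)\<^sup>2" if "x \<in> D" for x
  proof -
    define y where "y = x - P x"
    have y: "y \<in> D" "P y = 0" and x: "x = P x + y" "J x = y - P x"
      using that QD by (simp_all add: y_def P.diff P(2) J_def scaleR_2)
    have "A x = A (P x) + A y" using A_add[OF PD y(1)] x(1) by metis
    then have "A x \<bullet> J x = A y \<bullet> y - A (P x) \<bullet> P x"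
      using A_sym[OF y(1) PD, of x] unfolding x(2) by (simp add: inner_simps inner_commute)
    moreover have "(norm x)\<^sup>2 = (norm (P x))\<^sup>2 + (norm y)\<^sup>2"
    proof -
      have "P x \<bullet> y = 0" using P(3)[of x y] y(2) by simp
      then have "(norm (P x + y))\<^sup>2 = (norm (P x))\<^sup>2 + (norm y)\<^sup>2"
        by (simp add: power2_norm_eq_inner inner_simps inner_commute)
      then show ?thesis using x(1) by simp
    qed
    ultimately show ?thesis using neg[of x] pos[OF y] by (simp add: algebra_simps)
  qed
  obtain r0 where r0: "r0 > 0" "\<And>u. norm u \<ge> r0 \<Longrightarrow> norm (N u) \<le> c / 2 * norm u"
    using sublinear_bound[of N "c/2"] N_sub c by auto
  define R where "R = max r0 (2 * norm h / c + 1)"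
  have "R > 0" using r0(1) by (simp add: R_def)
  have "\<exists>u\<in>V n. norm u < R \<and> (\<forall>v\<in>V n. (A u + N u - h) \<bullet> v = 0)" for n
  proof -
    have "\<exists>u\<in>V n. norm u < R \<and> (\<forall>v\<in>V n. J (A u + N u - h) \<bullet> v = 0)"
      unfolding V_def
    proof (rule finite_dim_zero[OF finV \<open>R > 0\<close>])
      fix u x v assume u: "\<And>k. u k \<in> span (C \<union> d ` {..n})" "u \<longlonglongrightarrow> x"
        and x: "x \<in> span (C \<union> d ` {..n})" and v: "v \<in> span (C \<union> d ` {..n})"
      \<comment> \<open>moved to the test vector, the unbounded \<open>A\<close> becomes continuous in \<open>y\<close>\<close>
      have *: "J (A y + N y - h) \<bullet> v = y \<bullet> A (J v) + N y \<bullet> J v - h \<bullet> J v"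
        if "y \<in> V n" for y
      proof -
        have "y \<in> D" "J v \<in> D" using that v JV VD unfolding V_def by blast+
        then show ?thesis by (simp add: J_sym inner_simps A_sym)
      qed
      have "(\<lambda>k. u k \<bullet> A (J v) + N (u k) \<bullet> J v - h \<bullet> J v) \<longlonglongrightarrow> x \<bullet> A (J v) + N x \<bullet> J v - h \<bullet> J v"
        by (intro tendsto_intros u N_demi)
      then show "(\<lambda>k. J (A (u k) + N (u k) - h) \<bullet> v) \<longlonglongrightarrow> J (A x + N x - h) \<bullet> v"
        using u(1) x by (simp add: * V_def)
    next
      fix u assume u: "u \<in> span (C \<union> d ` {..n})" "R \<le> norm u"
      then have uD: "u \<in> D" using VD unfolding V_def by blast
      have un: "norm u \<ge> r0" "norm u \<ge> 2 * norm h / c + 1" using u(2) by (auto simp: R_def)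
      have "norm u > 0" using u(2) \<open>R > 0\<close> by linarith
      have "- (N u \<bullet> J u) \<le> norm (N u) * norm u"
        using Cauchy_Schwarz_ineq2[of "N u" "J u"] normJ[of u] by (simp add: abs_le_iff)
      also have "\<dots> \<le> c / 2 * norm u * norm u"
        using r0(2)[OF un(1)] by (intro mult_right_mono) auto
      finally have 1: "- (N u \<bullet> J u) \<le> c / 2 * (norm u)\<^sup>2" by (simp add: power2_eq_square)
      have 2: "h \<bullet> J u \<le> norm h * norm u"
        using Cauchy_Schwarz_ineq2[of h "J u"] normJ[of u] by (simp add: abs_le_iff)
      have "norm h < c / 2 * norm u" using un(2) c by (simp add: field_simps)
      then have "norm h * norm u < c / 2 * (norm u)\<^sup>2"
        using \<open>norm u > 0\<close> by (simp add: power2_eq_square)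
      then show "J (A u + N u - h) \<bullet> u > 0"
        using coercive[OF uD] 1 2 by (simp add: J_sym inner_simps)
    qed
    then obtain u where u: "u \<in> V n" "norm u < R" and z: "\<And>v. v \<in> V n \<Longrightarrow> J (A u + N u - h) \<bullet> v = 0"
      by blast
    have "(A u + N u - h) \<bullet> v = 0" if "v \<in> V n" for v
      using z[OF JV[OF that]] by (simp add: J_sym JJ)
    with u show ?thesis by blast
  qed
  then obtain u where uV: "\<And>n. u n \<in> V n" and uR: "\<And>n. norm (u n) < R"
    and gal: "\<And>n v. v \<in> V n \<Longrightarrow> (A (u n) + N (u n) - h) \<bullet> v = 0"
    by metis
  have uD: "u n \<in> D" for n using uV VD by blast
  obtain M where M: "\<And>n. norm (N (u n)) \<le> M"
    using N_bnd[of "range u"] uR unfolding bounded_iff by (auto intro: less_imp_le)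
  obtain \<phi> x where \<phi>: "strict_mono \<phi>" and weak_x: "\<And>v. (\<lambda>n. u (\<phi> n) \<bullet> v) \<longlonglongrightarrow> x \<bullet> v"
    using weak_sequential_compactness[OF S, of u R] uR less_imp_le by metis
  obtain \<psi> z where \<psi>: "strict_mono \<psi>" and weak_z: "\<And>v. (\<lambda>n. N (u (\<phi> (\<psi> n))) \<bullet> v) \<longlonglongrightarrow> z \<bullet> v"
    using weak_sequential_compactness[OF S, of "\<lambda>n. N (u (\<phi> n))" M] M by metis
  define w where "w n = u (\<phi> (\<psi> n))" for n
  have wD: "w n \<in> D" for n using uD by (simp add: w_def)
  have wx: "(\<lambda>n. w n \<bullet> v) \<longlonglongrightarrow> x \<bullet> v" for v
    using LIMSEQ_subseq_LIMSEQ[OF weak_x \<psi>, of v] by (simp add: w_def o_def)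
  have wz: "(\<lambda>n. N (w n) \<bullet> v) \<longlonglongrightarrow> z \<bullet> v" for v
    using weak_z by (simp add: w_def)
  have wR: "norm (w n) \<le> R" for n using uR less_imp_le by (auto simp: w_def)
  have ge: "n \<le> \<phi> (\<psi> n)" for n
    using seq_suble[OF \<phi>, of "\<psi> n"] seq_suble[OF \<psi>, of n] by linarith
  \<comment> \<open>every \<open>d m\<close> is an admissible test vector from index \<open>m\<close> on\<close>
  have weak_eq_d: "x \<bullet> A (d m) = (h - z) \<bullet> d m" for m
  proof -
    have "w n \<bullet> A (d m) = (h - N (w n)) \<bullet> d m" if "n \<ge> m" for n
    proof -
      have "d m \<in> V (\<phi> (\<psi> n))" using ge[of n] that by (intro dV) linarith
      from gal[OF this] show ?thesis
        using A_sym[OF wD dD, of n m] by (simp add: w_def inner_simps)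
    qed
    then have "\<forall>\<^sub>F n in sequentially. w n \<bullet> A (d m) = (h - N (w n)) \<bullet> d m"
      unfolding eventually_sequentially by blast
    moreover have "(\<lambda>n. (h - N (w n)) \<bullet> d m) \<longlonglongrightarrow> (h - z) \<bullet> d m"
      unfolding inner_diff_left by (intro tendsto_intros wz)
    ultimately have "(\<lambda>n. w n \<bullet> A (d m)) \<longlonglongrightarrow> (h - z) \<bullet> d m"
      using tendsto_cong by fast
    then show ?thesis using wx LIMSEQ_unique by blast
  qed
  have weak_eq: "A y \<bullet> x = y \<bullet> (h - z)" if y: "y \<in> D" for y
  proof -
    have "\<exists>n. dist (d n) y < inverse (real (Suc k)) \<and> dist (A (d n)) (A y) < inverse (real (Suc k))" for k
      using dense[OF y] by simp
    then obtain \<nu> where \<nu>: "\<And>k. dist (d (\<nu> k)) y < inverse (real (Suc k))"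
      "\<And>k. dist (A (d (\<nu> k))) (A y) < inverse (real (Suc k))" by metis
    have l1: "(\<lambda>k. d (\<nu> k)) \<longlonglongrightarrow> y"
      by (rule metric_tendsto_imp_tendsto[OF LIMSEQ_inverse_real_of_nat])
         (use \<nu>(1) less_imp_le in \<open>auto intro!: always_eventually\<close>)
    have l2: "(\<lambda>k. A (d (\<nu> k))) \<longlonglongrightarrow> A y"
      by (rule metric_tendsto_imp_tendsto[OF LIMSEQ_inverse_real_of_nat])
         (use \<nu>(2) less_imp_le in \<open>auto intro!: always_eventually\<close>)
    have "(\<lambda>k. x \<bullet> A (d (\<nu> k))) \<longlonglongrightarrow> x \<bullet> A y" by (intro tendsto_intros l2)
    moreover have "(\<lambda>k. (h - z) \<bullet> d (\<nu> k)) \<longlonglongrightarrow> (h - z) \<bullet> y" by (intro tendsto_intros l1)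
    ultimately have "x \<bullet> A y = (h - z) \<bullet> y"
      unfolding weak_eq_d using LIMSEQ_unique by blast
    then show ?thesis by (simp add: inner_commute)
  qed
  have xD: "x \<in> D" and Ax: "A x = h - z"
    using A_max[of x "h - z"] weak_eq by blast+
  define a where "a n = N (w n) \<bullet> (w n - x)" for n
  \<comment> \<open>test with \<open>w n\<close> itself; \<open>x\<close> need not lie in any Galerkin space, but \<open>A (w n) \<bullet> x = w n \<bullet> A x\<close> converges\<close>
  have defect: "(\<lambda>n. A (w n - x) \<bullet> (w n - x) + a n) \<longlonglongrightarrow> 0"
  proof -
    have "A (w n - x) \<bullet> (w n - x) + a n
        = (h - N (w n)) \<bullet> x - w n \<bullet> A x - A x \<bullet> (w n - x) + h \<bullet> (w n - x)" for n
    proof -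
      have "(A (w n) + N (w n) - h) \<bullet> w n = 0" using gal uV by (simp add: w_def)
      moreover have "A (w n) \<bullet> x = w n \<bullet> A x" by (intro A_sym wD xD)
      ultimately show ?thesis
        by (simp add: a_def A_diff[OF wD xD] inner_simps)
    qed
    moreover have "(\<lambda>n. (h - N (w n)) \<bullet> x - w n \<bullet> A x - A x \<bullet> (w n - x) + h \<bullet> (w n - x))
        \<longlonglongrightarrow> (h - z) \<bullet> x - x \<bullet> A x - (x \<bullet> A x - A x \<bullet> x) + (x \<bullet> h - h \<bullet> x)"
      unfolding inner_diff_left inner_diff_right inner_commute[of "A x" "w _"] inner_commute[of h "w _"]
      by (intro tendsto_intros wx wz)
    ultimately show ?thesis by (simp add: Ax inner_commute)
  qed
  have Pw: "(\<lambda>n. P (w n - x)) \<longlonglongrightarrow> 0" and APw: "(\<lambda>n. A (P (w n - x))) \<longlonglongrightarrow> 0"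
  proof -
    have cf: "(\<lambda>n. (w n - x) \<bullet> e) \<longlonglongrightarrow> 0" for e
      using tendsto_diff[OF wx tendsto_const, of e "x \<bullet> e"] by (simp add: inner_diff_left)
    have "(\<lambda>n. \<Sum>e\<in>C. ((w n - x) \<bullet> e) *\<^sub>R f e) \<longlonglongrightarrow> (\<Sum>e\<in>C. 0 *\<^sub>R f e)" for f :: "'a \<Rightarrow> 'a"
      by (intro tendsto_sum tendsto_scaleR cf tendsto_const)
    then have lim: "(\<lambda>n. \<Sum>e\<in>C. ((w n - x) \<bullet> e) *\<^sub>R f e) \<longlonglongrightarrow> 0" for f :: "'a \<Rightarrow> 'a"
      by simp
    show "(\<lambda>n. P (w n - x)) \<longlonglongrightarrow> 0" unfolding expand by (rule lim)
    have "A (\<Sum>e\<in>F. g e *\<^sub>R e) = (\<Sum>e\<in>F. g e *\<^sub>R A e) \<and> (\<Sum>e\<in>F. g e *\<^sub>R e) \<in> D"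
      if "F \<subseteq> C" for F and g :: "'a \<Rightarrow> real"
    proof -
      have "finite F" using that C(1) finite_subset by blast
      then show ?thesis using that
      proof (induction F)
        case empty
        then show ?case by (simp add: A_0 subspace_0[OF D])
      next
        case (insert e F)
        have "e \<in> D" "g e *\<^sub>R e \<in> D" using insert.prems CD subspace_scale[OF D] by auto
        then show ?case using insert by (simp add: A_add A_scale subspace_add[OF D])
      qed
    qed
    then show "(\<lambda>n. A (P (w n - x))) \<longlonglongrightarrow> 0" unfolding expand using lim by simp
  qed
  define q where "q n = w n - x - P (w n - x)" for n
  have qD: "q n \<in> D" "P (q n) = 0" for n
    using QD[of "w n - x"] subspace_diff[OF D wD xD] by (auto simp: q_def P.diff P(2))
  have Pbd: "norm (P y) \<le> norm y" for y
  proof -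
    have "(norm (P y))\<^sup>2 \<le> norm (P y) * norm y"
      using Cauchy_Schwarz_ineq2[of "P y" y] P(2,3) by (simp add: power2_norm_eq_inner abs_le_iff)
    then show ?thesis by (cases "P y = 0") (auto simp: power2_eq_square)
  qed
  have qbd: "norm (q n) \<le> 2 * (R + norm x)" for n
  proof -
    have "norm (w n - x) \<le> R + norm x" using norm_triangle_ineq4[of "w n" x] wR[of n] by linarith
    then show ?thesis
      using norm_triangle_ineq4[of "w n - x" "P (w n - x)"] Pbd[of "w n - x"] by (simp add: q_def)
  qed
  have small: "(\<lambda>n. 2 * (A (P (w n - x)) \<bullet> q n) + A (P (w n - x)) \<bullet> P (w n - x)) \<longlonglongrightarrow> 0"
  proof -
    have "(\<lambda>n. norm (A (P (w n - x))) * (2 * (R + norm x))) \<longlonglongrightarrow> norm (0::'a) * (2 * (R + norm x))"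
      by (intro tendsto_intros APw)
    then have "(\<lambda>n. norm (A (P (w n - x))) * (2 * (R + norm x))) \<longlonglongrightarrow> 0" by simp
    moreover have "norm (A (P (w n - x)) \<bullet> q n) \<le> norm (A (P (w n - x))) * (2 * (R + norm x))" for n
      using Cauchy_Schwarz_ineq2[of "A (P (w n - x))" "q n"]
        mult_left_mono[OF qbd[of n] norm_ge_zero[of "A (P (w n - x))"]] by simp
    ultimately have "(\<lambda>n. A (P (w n - x)) \<bullet> q n) \<longlonglongrightarrow> 0"
      by (intro Lim_null_comparison[of "\<lambda>n. A (P (w n - x)) \<bullet> q n"] always_eventually allI)
    from tendsto_add[OF tendsto_mult_left[OF this, of 2] tendsto_inner[OF APw Pw]]
    show ?thesis by simp
  qed
  have split: "A (w n - x) \<bullet> (w n - x) \<ge> c * (norm (q n))\<^sup>2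
      + (2 * (A (P (w n - x)) \<bullet> q n) + A (P (w n - x)) \<bullet> P (w n - x))" for n
  proof -
    define p where "p = P (w n - x)"
    have pD: "p \<in> D" using PD by (simp add: p_def)
    have s: "w n - x = p + q n" by (simp add: p_def q_def)
    have "A (q n) \<bullet> p = A p \<bullet> q n"
      using A_sym[OF qD(1) pD] inner_commute by metis
    then have "A (w n - x) \<bullet> (w n - x) = A (q n) \<bullet> q n + (2 * (A p \<bullet> q n) + A p \<bullet> p)"
      unfolding s using qD(1) pD by (simp add: A_add inner_simps)
    then show ?thesis using pos[OF qD] by (simp add: p_def)
  qed
  have "\<exists>n\<ge>k. norm (q n) < inverse (real (Suc k))" for k
  proof -
    define e where "e = c * (inverse (real (Suc k)))\<^sup>2 / 3"
    have "e > 0" using c by (simp add: e_def)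
    have "\<forall>\<^sub>F n in sequentially. A (w n - x) \<bullet> (w n - x) + a n < e"
      using order_tendstoD(2)[OF defect \<open>e > 0\<close>] .
    moreover have "\<forall>\<^sub>F n in sequentially.
        2 * (A (P (w n - x)) \<bullet> q n) + A (P (w n - x)) \<bullet> P (w n - x) > - e"
      using order_tendstoD(1)[OF small, of "- e"] \<open>e > 0\<close> by simp
    ultimately obtain k0 where k0: "\<And>n. n \<ge> k0 \<Longrightarrow> A (w n - x) \<bullet> (w n - x) + a n < e \<and>
        2 * (A (P (w n - x)) \<bullet> q n) + A (P (w n - x)) \<bullet> P (w n - x) > - e"
      using eventually_conj unfolding eventually_sequentially by (metis (no_types, lifting) nat_le_linear order_trans)
    obtain n where n: "n \<ge> max k k0" "a n > - e"
      using N_qm[OF wx \<open>e > 0\<close>] unfolding a_def by blast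
    then have "c * (norm (q n))\<^sup>2 < 3 * e" using k0[of n] split[of n] by auto
    also have "\<dots> = c * (inverse (real (Suc k)))\<^sup>2" by (simp add: e_def)
    finally have "(norm (q n))\<^sup>2 < (inverse (real (Suc k)))\<^sup>2"
      using c by (simp only: mult_less_cancel_left_pos)
    then have "norm (q n) < inverse (real (Suc k))"
      by (rule power_less_imp_less_base) simp
    then show ?thesis using n by auto
  qed
  then obtain \<nu> where \<nu>: "\<And>k. \<nu> k \<ge> k" "\<And>k. norm (q (\<nu> k)) < inverse (real (Suc k))" by metis
  have "filterlim \<nu> sequentially sequentially"
    using \<nu>(1) by (intro filterlim_at_top_mono[OF filterlim_ident]) auto
  have "(\<lambda>k. q (\<nu> k)) \<longlonglongrightarrow> 0"
    by (rule Lim_null_comparison[OF _ LIMSEQ_inverse_real_of_nat])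
       (use \<nu>(2) less_imp_le in \<open>blast intro: always_eventually\<close>)
  from tendsto_add[OF this filterlim_compose[OF Pw \<open>filterlim \<nu> sequentially sequentially\<close>]]
  have "(\<lambda>k. w (\<nu> k) - x) \<longlonglongrightarrow> 0" by (simp add: q_def)
  then have "(\<lambda>k. w (\<nu> k)) \<longlonglongrightarrow> x" by (simp add: LIM_zero_iff)
  then have "(\<lambda>k. N (w (\<nu> k)) \<bullet> v) \<longlonglongrightarrow> N x \<bullet> v" for v by (rule N_demi)
  moreover have "(\<lambda>k. N (w (\<nu> k)) \<bullet> v) \<longlonglongrightarrow> z \<bullet> v" for v
    using filterlim_compose[OF wz \<open>filterlim \<nu> sequentially sequentially\<close>] .
  ultimately have "N x \<bullet> v = z \<bullet> v" for v using LIMSEQ_unique by blast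
  then have "(N x - z) \<bullet> (N x - z) = 0" by (simp add: inner_diff_left)
  then have "N x = z" by simp
  with Ax xD show ?thesis by (intro bexI[of _ x]) auto
qed

section \<open>Complex and real inner products\<close>

lemma Im_cinner: "Im (cinner x y) = - ((\<i> *\<^sub>C x) \<bullet> y)" for x y :: "'a::complex_inner"
  by (simp add: inner_eq_Re_cinner cinner_scaleC_left)

lemma Im_cinner_right: "Im (cinner x y) = x \<bullet> (\<i> *\<^sub>C y)" for x y :: "'a::complex_inner"
  using Im_cinner[of y x] cinner_commute[of x y] by (simp add: inner_commute)

lemma scaleC_Re_Im: "c *\<^sub>C x = Re c *\<^sub>R x + Im c *\<^sub>R (\<i> *\<^sub>C x)" for x :: "'a::complex_inner"
proof -
  have "c *\<^sub>C x = (complex_of_real (Re c) + complex_of_real (Im c) * \<i>) *\<^sub>C x"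
    by (simp add: complex_eq mult.commute)
  then show ?thesis by (simp add: scaleC_add_left scaleR_scaleC scaleC_scaleC)
qed

text \<open>The imaginary part of a scalar product with \<open>v\<close> is the real inner product with \<open>\<i> v\<close>, so real
  test functionals suffice.\<close>

lemma weakly_converges_real:
  fixes u :: "nat \<Rightarrow> 'a::complex_inner"
  shows "weakly_converges u x \<longleftrightarrow> (\<forall>v. (\<lambda>k. u k \<bullet> v) \<longlonglongrightarrow> x \<bullet> v)"
  unfolding weakly_converges_def tendsto_complex_iff inner_eq_Re_cinner[symmetric] Im_cinner_right by blast

text \<open>Complex finite dimension implies real finite dimension, so that multiplicities of eigenvalues
  can be used in the real Hilbert space setting of the existence theorem.\<close>

lemma cspan_subset_span:
  fixes B :: "'a::complex_inner set"
  shows "cspan B \<subseteq> span (B \<union> (\<lambda>b. \<i> *\<^sub>C b) ` B)" (is "_ \<subseteq> ?S")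
proof -
  have i: "\<i> *\<^sub>C x \<in> ?S" if "x \<in> ?S" for x
    using that
  proof (induction rule: span_induct_alt)
    case base
    have "\<i> *\<^sub>C (0::'a) = 0" by (rule complex_vector.scale_zero_right)
    then show ?case by (simp add: span_zero)
  next
    case (step c x y)
    have "\<i> *\<^sub>C x \<in> ?S"
    proof (cases "x \<in> B")
      case True
      then show ?thesis by (intro span_base) auto
    next
      case False
      then obtain b where b: "b \<in> B" "x = \<i> *\<^sub>C b" using step by auto
      then have "\<i> *\<^sub>C x = (-1) *\<^sub>R b" by (simp add: scaleC_scaleC scaleR_scaleC)
      then show ?thesis using b span_scale[OF span_base, of b _ "-1"] by auto
    qed
    moreover have "\<i> *\<^sub>C (c *\<^sub>R x + y) = c *\<^sub>R (\<i> *\<^sub>C x) + \<i> *\<^sub>C y"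
      by (simp add: scaleR_scaleC scaleC_add_right scaleC_scaleC mult.commute)
    ultimately show ?case using step by (simp add: span_add span_scale)
  qed
  show ?thesis
  proof (rule complex_vector.span_minimal)
    show "B \<subseteq> ?S" by (auto intro: span_base)
    show "csubspace ?S"
    proof (rule complex_vector.subspaceI)
      show "c *\<^sub>C x \<in> ?S" if "x \<in> ?S" for c x
        using span_add[OF span_scale[OF that, of "Re c"] span_scale[OF i[OF that], of "Im c"]]
        by (simp only: scaleC_Re_Im[of c x, symmetric])
    qed (simp_all add: span_zero span_add)
  qed
qed

section \<open>Sums of finite Borel measures on the line\<close>

text \<open>A finite Borel measure is determined by its values on half-open intervals; here the identity
  \<open>M = M1 + M2\<close> is extended from these intervals to all Borel sets, and below to integrals. Total
  masses are compared separately because the whole line is not one of the intervals and the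
  complement step needs them.\<close>

lemma measure_sum_borel:
  fixes M M1 M2 :: "real measure"
  assumes fin: "finite_measure M" "finite_measure M1" "finite_measure M2"
    and sets: "sets M = sets borel" "sets M1 = sets borel" "sets M2 = sets borel"
    and UNIV: "measure M UNIV = measure M1 UNIV + measure M2 UNIV"
    and Ioc: "\<And>a b. a \<le> b \<Longrightarrow> measure M {a<..b} = measure M1 {a<..b} + measure M2 {a<..b}"
    and A: "A \<in> sets borel"
  shows "measure M A = measure M1 A + measure M2 A"
proof -
  interpret M: finite_measure M by fact
  interpret M1: finite_measure M1 by fact
  interpret M2: finite_measure M2 by fact
  let ?G = "range (\<lambda>(a, b). {a<..b::real})"
  have sp: "space M = UNIV" "space M1 = UNIV" "space M2 = UNIV"
    using sets[THEN sets_eq_imp_space_eq] by auto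
  have gen: "sigma_sets UNIV ?G = sets borel"
    unfolding borel_sigma_sets_Ioc by (simp add: sets_measure_of_conv)
  have "Int_stable ?G"
  proof (rule Int_stableI)
    fix X Y assume "X \<in> ?G" "Y \<in> ?G"
    then obtain a b c d where "X = {a<..b}" "Y = {c<..d}" by auto
    then have "X \<inter> Y = {max a c<..min b d}" by auto
    then show "X \<inter> Y \<in> ?G" by auto
  qed
  moreover have "?G \<subseteq> Pow UNIV" by simp
  moreover have "A \<in> sigma_sets UNIV ?G" using A gen by blast
  ultimately show ?thesis
  proof (induction rule: sigma_sets_induct_disjoint[where \<Omega> = UNIV])
    case (basic X)
    then obtain a b where X: "X = {a<..b}" by auto
    show ?case
    proof (cases "a \<le> b")
      case True
      then show ?thesis using Ioc X by simp
    next
      case False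
      then have "X = {}" using X by simp
      then show ?thesis by simp
    qed
  next
    case (compl X)
    then have "X \<in> sets M" "X \<in> sets M1" "X \<in> sets M2" by (simp_all add: sets gen)
    then show ?case
      using M.finite_measure_compl[of X] M1.finite_measure_compl[of X] M2.finite_measure_compl[of X]
      by (simp add: sp UNIV compl)
  next
    case (union X)
    then have "range X \<subseteq> sets M" "range X \<subseteq> sets M1" "range X \<subseteq> sets M2" by (auto simp: sets gen)
    then have "(\<lambda>i. measure M (X i)) sums measure M (\<Union>i. X i)"
      "(\<lambda>i. measure M1 (X i) + measure M2 (X i)) sums (measure M1 (\<Union>i. X i) + measure M2 (\<Union>i. X i))"
      using union by (intro sums_add M.finite_measure_UNION M1.finite_measure_UNION M2.finite_measure_UNION; simp)+
    then show ?case using union sums_unique2 by simp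
  qed auto
qed

lemma nn_integral_sum_borel:
  fixes M M1 M2 :: "real measure" and f :: "real \<Rightarrow> ennreal"
  assumes sets: "sets M = sets borel" "sets M1 = sets borel" "sets M2 = sets borel"
    and eq: "\<And>A. A \<in> sets borel \<Longrightarrow> emeasure M A = emeasure M1 A + emeasure M2 A"
    and f: "f \<in> borel_measurable borel"
  shows "nn_integral M f = nn_integral M1 f + nn_integral M2 f"
  using f
proof (induction rule: borel_measurable_induct)
  case (cong f g)
  then show ?case by (simp cong: nn_integral_cong)
next
  case (set A)
  then show ?case by (simp add: eq sets)
next
  case (mult u c)
  have [measurable]: "u \<in> borel_measurable M" "u \<in> borel_measurable M1" "u \<in> borel_measurable M2"
    using mult(2) sets measurable_cong_sets by blast+
  show ?case using mult by (simp add: nn_integral_cmult distrib_left)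
next
  case (add u v)
  have [measurable]: "u \<in> borel_measurable M" "u \<in> borel_measurable M1" "u \<in> borel_measurable M2"
    "v \<in> borel_measurable M" "v \<in> borel_measurable M1" "v \<in> borel_measurable M2"
    using add(1,3) sets measurable_cong_sets by blast+
  show ?case using add by (simp add: nn_integral_add ac_simps)
next
  case (seq U)
  have [measurable]: "U i \<in> borel_measurable M" "U i \<in> borel_measurable M1" "U i \<in> borel_measurable M2" for i
    using seq.hyps(1) sets measurable_cong_sets by blast+
  have inc: "incseq (\<lambda>i. nn_integral M1 (U i))" "incseq (\<lambda>i. nn_integral M2 (U i))"
    using \<open>incseq U\<close> by (auto simp: incseq_def le_fun_def intro!: nn_integral_mono)
  have SUP: "nn_integral K (SUP i. U i) = (SUP i. nn_integral K (U i))" if "K \<in> {M, M1, M2}" for K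
    unfolding SUP_apply[abs_def] using that \<open>incseq U\<close>
    by (intro nn_integral_monotone_convergence_SUP) auto
  have "(SUP i. nn_integral M (U i)) = (SUP i. nn_integral M1 (U i)) + (SUP i. nn_integral M2 (U i))"
    unfolding ennreal_SUP_add[OF inc, symmetric] by (simp add: seq.IH)
  then show ?case by (simp only: SUP insert_iff simp_thms)
qed

lemma integral_sum_borel:
  fixes M M1 M2 :: "real measure" and f :: "real \<Rightarrow> real"
  assumes fin: "finite_measure M" "finite_measure M1" "finite_measure M2"
    and sets: "sets M = sets borel" "sets M1 = sets borel" "sets M2 = sets borel"
    and UNIV: "measure M UNIV = measure M1 UNIV + measure M2 UNIV"
    and Ioc: "\<And>a b. a \<le> b \<Longrightarrow> measure M {a<..b} = measure M1 {a<..b} + measure M2 {a<..b}"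
    and int: "integrable M f" "integrable M1 f" "integrable M2 f"
  shows "(\<integral>x. f x \<partial>M) = (\<integral>x. f x \<partial>M1) + (\<integral>x. f x \<partial>M2)"
proof -
  interpret M: finite_measure M by fact
  interpret M1: finite_measure M1 by fact
  interpret M2: finite_measure M2 by fact
  have em: "emeasure M A = emeasure M1 A + emeasure M2 A" if "A \<in> sets borel" for A
    using measure_sum_borel[OF fin sets UNIV Ioc that]
    by (simp add: M.emeasure_eq_measure M1.emeasure_eq_measure M2.emeasure_eq_measure)
  have nn: "nn_integral M g = nn_integral M1 g + nn_integral M2 g" if "g \<in> borel_measurable borel" for g
    by (rule nn_integral_sum_borel[OF sets em that])
  have fm: "f \<in> borel_measurable borel"
    using borel_measurable_integrable[OF int(1)] sets(1) measurable_cong_sets by blast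
  have "(\<lambda>x. ennreal (f x)) \<in> borel_measurable borel" "(\<lambda>x. ennreal (- f x)) \<in> borel_measurable borel"
    using fm by measurable
  from nn[OF this(1)] nn[OF this(2)]
  have "(\<integral>\<^sup>+x. ennreal (f x) \<partial>M) = (\<integral>\<^sup>+x. ennreal (f x) \<partial>M1) + (\<integral>\<^sup>+x. ennreal (f x) \<partial>M2)"
    "(\<integral>\<^sup>+x. ennreal (- f x) \<partial>M) = (\<integral>\<^sup>+x. ennreal (- f x) \<partial>M1) + (\<integral>\<^sup>+x. ennreal (- f x) \<partial>M2)"
    .
  then show ?thesis
    using int by (simp add: real_lebesgue_integral_def real_integrable_def enn2real_plus less_top)
qed

section \<open>Spectral subspaces of a self-adjoint operator\<close>

text \<open>All that links the operator to its spectral family is the domain and the diagonal of the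
  quadratic form. From this it has to be recovered that spectral subspaces over bounded intervals
  are invariant under \<open>L\<close>; only then can their size be compared with the spectrum of \<open>L\<close>.\<close>

locale spectral_resolution =
  fixes D :: "'a::chilbert_space set" and L :: "'a \<Rightarrow> 'a" and E :: "real \<Rightarrow> 'a \<Rightarrow> 'a"
  assumes sa: "self_adjoint D L" and sf: "spectral_family_of D L E"
begin

lemma D_csubspace: "csubspace D"
  and L_add: "x \<in> D \<Longrightarrow> y \<in> D \<Longrightarrow> L (x + y) = L x + L y"
  and L_scaleC: "x \<in> D \<Longrightarrow> L (c *\<^sub>C x) = c *\<^sub>C L x"
  and D_dense: "closure D = UNIV"
  using sa by (auto simp: self_adjoint_def linear_operator_def)

lemma L_scaleR: "x \<in> D \<Longrightarrow> L (r *\<^sub>R x) = r *\<^sub>R L x"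
  by (simp add: scaleR_scaleC L_scaleC)

lemma D_scaleC: "x \<in> D \<Longrightarrow> c *\<^sub>C x \<in> D"
  using D_csubspace by (rule complex_vector.subspace_scale)

lemma D_subspace: "subspace D"
  using complex_vector.subspace_0[OF D_csubspace] complex_vector.subspace_add[OF D_csubspace] D_scaleC
  by (auto simp: subspace_def scaleR_scaleC)

lemma L_diff: "x \<in> D \<Longrightarrow> y \<in> D \<Longrightarrow> L (x - y) = L x - L y"
  using L_add[of x "- 1 *\<^sub>R y"] L_scaleR[of y "-1"] subspace_neg[OF D_subspace, of y] by simp

lemma L_sym: "x \<in> D \<Longrightarrow> y \<in> D \<Longrightarrow> L x \<bullet> y = x \<bullet> L y"
proof -
  assume "x \<in> D" "y \<in> D"
  then have "(y, L y) \<in> adjoint_graph D L"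
    using sa by (auto simp: self_adjoint_def operator_graph_def)
  then show ?thesis using \<open>x \<in> D\<close> by (auto simp: adjoint_graph_def inner_eq_Re_cinner)
qed

lemma L_maximal:
  assumes "\<And>x. x \<in> D \<Longrightarrow> L x \<bullet> u = x \<bullet> w"
  shows "u \<in> D \<and> L u = w"
proof -
  have "cinner (L x) u = cinner x w" if "x \<in> D" for x
  proof (rule complex_eqI)
    show "Re (cinner (L x) u) = Re (cinner x w)" using assms[OF that] by (simp add: inner_eq_Re_cinner)
    show "Im (cinner (L x) u) = Im (cinner x w)"
      using assms[OF D_scaleC[OF that, of \<i>]] by (simp add: Im_cinner L_scaleC[OF that])
  qed
  then have "(u, w) \<in> operator_graph D L"
    using sa by (auto simp: self_adjoint_def adjoint_graph_def)
  then show ?thesis by (auto simp: operator_graph_def)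
qed

lemma E_proj: "orthogonal_projection (E \<mu>)"
  and EE: "E \<mu> (E \<nu> x) = E (min \<mu> \<nu>) x"
  and E_right: "((\<lambda>\<nu>. E \<nu> x) \<longlongrightarrow> E \<mu> x) (at_right \<mu>)"
  and E_bot: "((\<lambda>\<mu>. E \<mu> x) \<longlongrightarrow> 0) at_bot"
  and E_top: "((\<lambda>\<mu>. E \<mu> x) \<longlongrightarrow> x) at_top"
  and D_eq: "D = {x. integrable (stieltjes E x) (\<lambda>\<mu>. \<mu>\<^sup>2)}"
  and form_eq: "x \<in> D \<Longrightarrow> cinner (L x) x = complex_of_real (\<integral>\<mu>. \<mu> \<partial>stieltjes E x)"
  using sf unfolding spectral_family_of_def spectral_family_def by blast+

lemma E_linear: "linear (E \<mu>)"
proof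
  have "Vector_Spaces.linear scaleC scaleC (E \<mu>)"
    using E_proj by (auto simp: orthogonal_projection_def)
  then interpret l: Vector_Spaces.linear scaleC scaleC "E \<mu>" .
  show "E \<mu> (x + y) = E \<mu> x + E \<mu> y" for x y by (rule l.add)
  show "E \<mu> (r *\<^sub>R x) = r *\<^sub>R E \<mu> x" for r x by (simp add: scaleR_scaleC l.scale)
qed

lemmas E_add = linear_add[OF E_linear]
  and E_diff = linear_diff[OF E_linear]
  and E_scaleR = linear_scale[OF E_linear]
  and E_zero = linear_0[OF E_linear]

lemma E_csym: "cinner (E \<mu> x) y = cinner x (E \<mu> y)"
  using E_proj by (auto simp: orthogonal_projection_def)

lemma E_sym: "E \<mu> x \<bullet> y = x \<bullet> E \<mu> y"
  by (simp add: inner_eq_Re_cinner E_csym)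

lemma E_idem: "E \<mu> (E \<mu> x) = E \<mu> x"
  using EE[of \<mu> \<mu>] by simp

lemma E_norm: "(norm (E \<mu> x))\<^sup>2 = E \<mu> x \<bullet> x"
  using E_sym[of \<mu> "E \<mu> x" x] by (simp add: power2_norm_eq_inner E_idem)

lemma E_contr: "norm (E \<mu> x) \<le> norm x"
proof (cases "E \<mu> x = 0")
  case False
  have "norm (E \<mu> x) * norm (E \<mu> x) \<le> norm (E \<mu> x) * norm x"
    using E_norm[of \<mu> x] Cauchy_Schwarz_ineq2[of "E \<mu> x" x] by (simp add: power2_eq_square)
  then show ?thesis using False by simp
qed simp

lemma E_mono: "\<mu> \<le> \<nu> \<Longrightarrow> norm (E \<mu> x) \<le> norm (E \<nu> x)"
  using E_contr[of \<mu> "E \<nu> x"] by (simp add: EE)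

lemma emeasure_stieltjes:
  "a \<le> b \<Longrightarrow> emeasure (stieltjes E x) {a<..b} = ennreal ((norm (E b x))\<^sup>2 - (norm (E a x))\<^sup>2)"
  unfolding stieltjes_def
proof (rule emeasure_interval_measure_Ioc)
  show "(norm (E \<mu> x))\<^sup>2 \<le> (norm (E \<nu> x))\<^sup>2" if "\<mu> \<le> \<nu>" for \<mu> \<nu>
    by (intro power_mono E_mono that) simp
  show "continuous (at_right a) (\<lambda>\<mu>. (norm (E \<mu> x))\<^sup>2)" for a
    unfolding continuous_within by (intro tendsto_intros E_right)
qed

lemma sets_stieltjes [simp]: "sets (stieltjes E x) = sets borel"
  and space_stieltjes [simp]: "space (stieltjes E x) = UNIV"
  by (simp_all add: stieltjes_def)

lemma emeasure_stieltjes_UNIV: "emeasure (stieltjes E x) UNIV = ennreal ((norm x)\<^sup>2)"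
proof -
  have n: "filterlim (\<lambda>n. real n) at_top sequentially" by (rule filterlim_real_sequentially)
  have "(\<lambda>n. (norm (E (real n) x))\<^sup>2 - (norm (E (- real n) x))\<^sup>2) \<longlonglongrightarrow> (norm x)\<^sup>2 - (norm (0::'a))\<^sup>2"
    by (intro tendsto_intros filterlim_compose[OF E_top n]
        filterlim_compose[OF E_bot filterlim_compose[OF filterlim_uminus_at_bot_at_top n]])
  then have "(\<lambda>n. ennreal ((norm (E (real n) x))\<^sup>2 - (norm (E (- real n) x))\<^sup>2)) \<longlonglongrightarrow> ennreal ((norm x)\<^sup>2)"
    by (intro tendsto_ennrealI) simp
  moreover have "(\<lambda>n. emeasure (stieltjes E x) {- real n<..real n}) \<longlonglongrightarrow>
      emeasure (stieltjes E x) (\<Union>n. {- real n<..real n})"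
    by (intro Lim_emeasure_incseq) (auto simp: incseq_def)
  moreover have "(\<Union>n. {- real n<..real n}) = UNIV"
  proof -
    have "\<exists>n. y \<in> {- real n<..real n}" for y
    proof -
      obtain n where "\<bar>y\<bar> < real n" using reals_Archimedean2 by blast
      then show ?thesis by (intro exI[of _ n]) auto
    qed
    then show ?thesis by blast
  qed
  ultimately show ?thesis using LIMSEQ_unique by (simp add: emeasure_stieltjes)
qed

lemma finite_stieltjes: "finite_measure (stieltjes E x)"
  by (rule finite_measureI) (simp add: emeasure_stieltjes_UNIV)

lemma measure_stieltjes_UNIV: "measure (stieltjes E x) UNIV = (norm x)\<^sup>2"
  by (simp add: measure_def emeasure_stieltjes_UNIV)

lemma AE_stieltjes_above:
  assumes "E a x = 0"
  shows "AE \<mu> in stieltjes E x. a < \<mu>"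
proof -
  have "emeasure (stieltjes E x) (\<Union>n. {a - real n<..a}) = 0"
    by (rule emeasure_UN_eq_0) (auto simp: emeasure_stieltjes assms ennreal_neg)
  moreover have "(\<Union>n. {a - real n<..a}) = {..a}"
  proof -
    have "\<exists>n. a - real n < y" for y
      using reals_Archimedean2[of "a - y"] by (auto simp: algebra_simps)
    then show ?thesis by auto
  qed
  ultimately show ?thesis
    by (intro AE_I[of _ _ "{..a}"]) auto
qed

lemma AE_stieltjes_below:
  assumes "E b x = x"
  shows "AE \<mu> in stieltjes E x. \<mu> \<le> b"
proof -
  have "E (b + real n) x = x" for n using EE[of "b + real n" b x] assms by (simp add: min_def)
  then have "emeasure (stieltjes E x) (\<Union>n. {b<..b + real n}) = 0"
    by (intro emeasure_UN_eq_0) (auto simp: emeasure_stieltjes assms)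
  moreover have "(\<Union>n. {b<..b + real n}) = {b<..}"
  proof -
    have "\<exists>n. y \<le> b + real n" for y
      using reals_Archimedean2[of "y - b"] by (auto simp: algebra_simps intro: less_imp_le)
    then show ?thesis by auto
  qed
  ultimately show ?thesis
    by (intro AE_I[of _ _ "{b<..}"]) auto
qed

lemma integrable_id:
  assumes "x \<in> D"
  shows "integrable (stieltjes E x) (\<lambda>\<mu>. \<mu>)"
proof (rule Bochner_Integration.integrable_bound)
  interpret finite_measure "stieltjes E x" by (rule finite_stieltjes)
  show "integrable (stieltjes E x) (\<lambda>\<mu>. 1 + \<mu>\<^sup>2)"
    using assms by (intro Bochner_Integration.integrable_add) (auto simp: D_eq)
  show "(\<lambda>\<mu>. \<mu>) \<in> borel_measurable (stieltjes E x)"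
    by (simp add: measurable_cong_sets[OF sets_stieltjes refl])
  have "\<bar>\<mu>\<bar> \<le> 1 + \<mu>\<^sup>2" for \<mu> :: real
  proof -
    have "0 \<le> (\<bar>\<mu>\<bar> - 1)\<^sup>2" by simp
    then have "2 * \<bar>\<mu>\<bar> \<le> 1 + \<mu>\<^sup>2" by (simp add: power2_diff)
    then show ?thesis by linarith
  qed
  then show "AE \<mu> in stieltjes E x. norm \<mu> \<le> norm (1 + \<mu>\<^sup>2)" by (simp add: order_trans[OF _ abs_ge_self])
qed

lemma form_integral: "x \<in> D \<Longrightarrow> L x \<bullet> x = (\<integral>\<mu>. \<mu> \<partial>stieltjes E x)"
  by (simp add: inner_eq_Re_cinner form_eq)

text \<open>If \<open>E a x = 0\<close>, the spectral measure of \<open>x\<close> lives on the half-line above \<open>a\<close>, and the form is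
  at least \<open>a\<close> times its total mass. The upper bound is symmetric, and with both conditions the
  support is bounded, so that \<open>x\<close> lies in the domain.\<close>

lemma form_lower:
  assumes "x \<in> D" "E a x = 0"
  shows "L x \<bullet> x \<ge> a * (norm x)\<^sup>2"
proof -
  interpret finite_measure "stieltjes E x" by (rule finite_stieltjes)
  have "(\<integral>\<mu>. a \<partial>stieltjes E x) \<le> (\<integral>\<mu>. \<mu> \<partial>stieltjes E x)"
    using AE_stieltjes_above[OF assms(2)]
    by (intro integral_mono_AE integrable_id assms integrable_const) (auto elim: AE_mp)
  then show ?thesis by (simp add: form_integral assms measure_stieltjes_UNIV mult.commute)
qed

lemma form_upper:
  assumes "x \<in> D" "E b x = x"
  shows "L x \<bullet> x \<le> b * (norm x)\<^sup>2"
proof -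
  interpret finite_measure "stieltjes E x" by (rule finite_stieltjes)
  have "(\<integral>\<mu>. \<mu> \<partial>stieltjes E x) \<le> (\<integral>\<mu>. b \<partial>stieltjes E x)"
    using AE_stieltjes_below[OF assms(2)]
    by (intro integral_mono_AE integrable_id assms integrable_const) auto
  then show ?thesis by (simp add: form_integral assms measure_stieltjes_UNIV mult.commute)
qed

lemma band_in_D:
  assumes "E a x = 0" "E b x = x"
  shows "x \<in> D"
proof -
  interpret finite_measure "stieltjes E x" by (rule finite_stieltjes)
  have "integrable (stieltjes E x) (\<lambda>\<mu>. \<mu>\<^sup>2)"
  proof (rule integrable_const_bound)
    show "AE \<mu> in stieltjes E x. norm (\<mu>\<^sup>2) \<le> a\<^sup>2 + b\<^sup>2"
      using AE_stieltjes_above[OF assms(1)] AE_stieltjes_below[OF assms(2)]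
    proof eventually_elim
      case (elim \<mu>)
      have "\<mu>\<^sup>2 \<le> a\<^sup>2 + b\<^sup>2"
      proof (cases "\<mu> \<ge> 0")
        case True
        then have "\<mu>\<^sup>2 \<le> b\<^sup>2" using elim by (intro power_mono) auto
        then show ?thesis by (simp add: add_increasing)
      next
        case False
        then have "(- \<mu>)\<^sup>2 \<le> (- a)\<^sup>2" using elim by (intro power_mono) auto
        then show ?thesis by (simp add: add_increasing2)
      qed
      then show ?case by simp
    qed
    show "(\<lambda>\<mu>. \<mu>\<^sup>2) \<in> borel_measurable (stieltjes E x)"
      by (simp add: measurable_cong_sets[OF sets_stieltjes refl])
  qed
  then show ?thesis by (simp add: D_eq)
qed

text \<open>When the cross terms vanish, the distribution function of \<open>x + y\<close> is the sum of those of \<open>x\<close>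
  and \<open>y\<close>, so the spectral measures and hence the quadratic forms add up. This is how information
  about \<open>L\<close> off the diagonal is gained.\<close>

lemma form_orthogonal:
  assumes x: "x \<in> D" and y: "y \<in> D" and orth: "\<And>\<mu>. E \<mu> x \<bullet> E \<mu> y = 0"
  shows "L x \<bullet> y = 0"
proof -
  have xy: "x + y \<in> D" using x y by (rule subspace_add[OF D_subspace])
  have N: "(norm (E \<mu> (x + y)))\<^sup>2 = (norm (E \<mu> x))\<^sup>2 + (norm (E \<mu> y))\<^sup>2" for \<mu>
    using orth[of \<mu>] by (simp add: E_add power2_norm_eq_inner inner_simps inner_commute)
  have xy0: "x \<bullet> y = 0"
  proof -
    have "((\<lambda>\<mu>. E \<mu> x \<bullet> E \<mu> y) \<longlongrightarrow> x \<bullet> y) at_top" by (intro tendsto_inner E_top)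
    then show ?thesis unfolding orth by (simp add: tendsto_const_iff)
  qed
  have m: "measure (stieltjes E v) {a<..b} = (norm (E b v))\<^sup>2 - (norm (E a v))\<^sup>2" if "a \<le> b" for v a b
    using that E_mono[OF that, of v] by (simp add: measure_def emeasure_stieltjes power_mono)
  have "(\<integral>\<mu>. \<mu> \<partial>stieltjes E (x + y)) = (\<integral>\<mu>. \<mu> \<partial>stieltjes E x) + (\<integral>\<mu>. \<mu> \<partial>stieltjes E y)"
  proof (intro integral_sum_borel finite_stieltjes integrable_id x y xy sets_stieltjes)
    show "measure (stieltjes E (x + y)) UNIV = measure (stieltjes E x) UNIV + measure (stieltjes E y) UNIV"
      using xy0 by (simp add: measure_stieltjes_UNIV power2_norm_eq_inner inner_simps inner_commute)
  qed (simp add: m N)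
  then have "L (x + y) \<bullet> (x + y) = L x \<bullet> x + L y \<bullet> y"
    by (simp add: form_integral x y xy)
  then show ?thesis
    using L_sym[OF x y] by (simp add: L_add x y inner_simps inner_commute)
qed

lemma band_vector: "a \<le> b \<Longrightarrow> E a (E b x - E a x) = 0" "a \<le> b \<Longrightarrow> E b (E b x - E a x) = E b x - E a x"
  by (simp_all add: E_diff EE min_absorb1 min_absorb2)

lemma band_vector_in_D: "a \<le> b \<Longrightarrow> E b x - E a x \<in> D"
  using band_vector band_in_D by blast

text \<open>For \<open>k\<close> in the range of \<open>E b - E a\<close> and \<open>v\<close> in the domain, the component of \<open>v\<close> orthogonal to
  this range again lies in the domain, and it is spectrally orthogonal to \<open>k\<close>. Hence \<open>L k\<close> is
  orthogonal to it, and by density of the domain \<open>L k\<close> has no component outside the range.\<close>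

lemma band_invariant:
  assumes ab: "a \<le> b" and k: "E a k = 0" "E b k = k"
  shows "E a (L k) = 0" "E b (L k) = L k"
proof -
  define w where "w = L k - (E b (L k) - E a (L k))"
  have kD: "k \<in> D" using k by (rule band_in_D)
  have "w \<bullet> v = 0" if v: "v \<in> D" for v
  proof -
    define v' where "v' = v - (E b v - E a v)"
    have v'D: "v' \<in> D" unfolding v'_def using v band_vector_in_D[OF ab] subspace_diff[OF D_subspace] by blast
    have v': "E b v' = E a v'"
      unfolding v'_def using band_vector[OF ab, of v] by (simp add: E_diff)
    have "E \<mu> k \<bullet> E \<mu> v' = 0" for \<mu>
    proof -
      have "E b (E \<mu> k) = E \<mu> k" "E a (E \<mu> k) = 0"
        using k EE[of b \<mu> k] EE[of \<mu> b k] EE[of a \<mu> k] EE[of \<mu> a k]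
        by (simp_all add: min.commute E_zero)
      then have "E \<mu> k \<bullet> v' = E \<mu> k \<bullet> E b v' - E \<mu> k \<bullet> E a v'"
        using E_sym[of b "E \<mu> k" v'] E_sym[of a "E \<mu> k" v'] by simp
      then show ?thesis using v' E_sym[of \<mu> "E \<mu> k" v'] by (simp add: E_idem)
    qed
    then have "L k \<bullet> v' = 0" by (rule form_orthogonal[OF kD v'D])
    then show ?thesis by (simp add: w_def v'_def inner_simps E_sym)
  qed
  then have "D \<subseteq> {v. w \<bullet> v = 0}" by blast
  moreover have "closed {v. w \<bullet> v = 0}" by (intro closed_Collect_eq continuous_intros)
  ultimately have "closure D \<subseteq> {v. w \<bullet> v = 0}" by (rule closure_minimal)
  then have "w \<bullet> w = 0" using D_dense by blast
  then have "L k = E b (L k) - E a (L k)" by (simp add: w_def)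
  then show "E a (L k) = 0" "E b (L k) = L k" using band_vector[OF ab, of "L k"] by metis+
qed

text \<open>On the range of \<open>E b - E a\<close> the symmetric operator \<open>L - z\<close> has its quadratic form bounded by
  \<open>b - a\<close>; since the range is invariant, polarization turns this into a bound on the norm.\<close>

lemma band_norm_bound:
  assumes z: "a \<le> z" "z \<le> b" and k: "E a k = 0" "E b k = k"
  shows "norm (L k - z *\<^sub>R k) \<le> (b - a) * norm k"
proof (cases "a = b")
  case True
  then have "k = 0" using k by simp
  moreover have "L 0 = 0" using L_scaleR[of 0 0] subspace_0[OF D_subspace] by simp
  ultimately show ?thesis by simp
next
  case False
  define c where "c = b - a"
  have c: "c > 0" using False z by (simp add: c_def)
  have ab: "a \<le> b" using z by simp
  define K where "K = {w. E a w = 0 \<and> E b w = w}"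
  have KD: "w \<in> D" if "w \<in> K" for w using that band_in_D by (auto simp: K_def)
  have K: "subspace K" by (auto simp: subspace_def K_def E_add E_scaleR E_zero)
  define T where "T w = L w - z *\<^sub>R w" for w
  have form: "\<bar>T w \<bullet> w\<bar> \<le> c * (norm w)\<^sup>2" if "w \<in> K" for w
  proof -
    have "a * (norm w)\<^sup>2 \<le> L w \<bullet> w" "L w \<bullet> w \<le> b * (norm w)\<^sup>2"
      using form_lower[OF KD[OF that]] form_upper[OF KD[OF that]] that by (auto simp: K_def)
    moreover have "a * (norm w)\<^sup>2 \<le> z * (norm w)\<^sup>2" "z * (norm w)\<^sup>2 \<le> b * (norm w)\<^sup>2"
      using z by (auto intro: mult_right_mono)
    ultimately show ?thesis
      by (simp add: T_def c_def inner_diff_left power2_norm_eq_inner left_diff_distrib abs_le_iff)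
  qed
  \<comment> \<open>this scaling makes the two squares in the polarization identity balance\<close>
  define y where "y = (1 / c) *\<^sub>R T k"
  have kK: "k \<in> K" using k by (simp add: K_def)
  have "T k \<in> K"
    unfolding T_def using band_invariant[OF ab k] k by (auto simp: K_def E_diff E_scaleR)
  then have yK: "y \<in> K" unfolding y_def by (rule subspace_scale[OF K])
  have Tk: "T k = c *\<^sub>R y" using c by (simp add: y_def)
  have "T y \<bullet> k = T k \<bullet> y"
    using L_sym[OF KD[OF yK] KD[OF kK]] by (simp add: T_def inner_simps inner_commute)
  then have "4 * (T k \<bullet> y) = T (k + y) \<bullet> (k + y) - T (k - y) \<bullet> (k - y)"
    using KD[OF kK] KD[OF yK] by (simp add: T_def L_add L_diff inner_simps inner_commute algebra_simps)
  also have "\<dots> \<le> c * (norm (k + y))\<^sup>2 + c * (norm (k - y))\<^sup>2"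
    using form[OF subspace_add[OF K kK yK]] form[OF subspace_diff[OF K kK yK]] by linarith
  also have "\<dots> = 2 * c * (norm k)\<^sup>2 + 2 * c * (norm y)\<^sup>2"
    by (simp add: power2_norm_eq_inner inner_simps inner_commute algebra_simps)
  finally have "c * (norm y)\<^sup>2 \<le> c * (norm k)\<^sup>2"
    by (simp add: Tk power2_norm_eq_inner)
  then have "(norm y)\<^sup>2 \<le> (norm k)\<^sup>2" using c by (simp only: mult_le_cancel_left_pos)
  then have "norm y \<le> norm k" by (rule power2_le_imp_le) simp
  then have "norm (T k) \<le> c * norm k" unfolding Tk using c by simp
  then show ?thesis by (simp add: T_def c_def)
qed

text \<open>A nonzero vector in the range of \<open>E b - E a\<close> with \<open>z\<close> between \<open>a\<close> and \<open>b\<close> is an approximate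
  eigenvector with defect \<open>b - a\<close>. If \<open>L - z\<close> has a bounded inverse, there is none as soon as
  \<open>b - a\<close> is small.\<close>

lemma resolvent_locally_constant:
  assumes "complex_of_real z \<in> resolvent_set D L"
  shows "\<exists>d>0. \<forall>a b. a \<le> z \<and> z \<le> b \<and> b - a < d \<longrightarrow> E a = E b"
proof -
  define T where "T x = L x - complex_of_real z *\<^sub>C x" for x
  have T: "bij_betw T D UNIV" "bounded_linear (inv_into D T)"
    using assms by (auto simp: resolvent_set_def T_def[abs_def])
  obtain C where C: "C > 0" "\<And>y. norm (inv_into D T y) \<le> norm y * C"
    using bounded_linear.pos_bounded[OF T(2)] by blast
  have "E a x = E b x" if "a \<le> z \<and> z \<le> b \<and> b - a < 1 / C" for a b x
  proof (rule ccontr)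
    define k where "k = E b x - E a x"
    assume "E a x \<noteq> E b x"
    then have k0: "norm k > 0" by (simp add: k_def)
    have k: "E a k = 0" "E b k = k" using that band_vector[of a b x] by (auto simp: k_def)
    have "inv_into D T (T k) = k"
      using band_in_D[OF k] T(1) by (intro inv_into_f_f) (auto simp: bij_betw_def)
    then have "norm k \<le> norm (T k) * C" using C(2)[of "T k"] by simp
    also have "\<dots> \<le> ((b - a) * norm k) * C"
      using band_norm_bound[OF _ _ k, of z] that C(1) by (intro mult_right_mono) (auto simp: T_def scaleR_scaleC)
    also have "\<dots> < norm k"
    proof -
      have "(b - a) * C < 1" using that C(1) by (simp add: field_simps)
      then show ?thesis using k0 by (simp add: mult.commute mult.left_commute)
    qed
    finally show False by simp
  qed
  then show ?thesis using C(1) by (intro exI[of _ "1 / C"]) auto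
qed

lemma resolvent_constant:
  assumes "a \<le> b" and "\<And>t. a \<le> t \<Longrightarrow> t \<le> b \<Longrightarrow> complex_of_real t \<in> resolvent_set D L"
  shows "E a = E b"
  using assms(1)
proof (induction rule: Bolzano)
  case (local x)
  then show ?case using resolvent_locally_constant assms(2) by blast
qed auto

definition finite_band :: "real \<Rightarrow> real \<Rightarrow> bool" where
  "finite_band a b \<longleftrightarrow> (\<exists>B. finite B \<and> (\<forall>x. E b x - E a x \<in> span B))"

text \<open>The case of interest is an isolated point \<open>z\<close> of the spectrum of finite multiplicity: around it
  the spectral family is constant apart from a jump at \<open>z\<close>. Vectors in the range of \<open>E b - E a\<close>
  then belong to arbitrarily narrow bands around \<open>z\<close> and so are eigenvectors.\<close>

lemma finite_band_local:
  assumes "complex_of_real z \<notin> essential_spectrum D L"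
  shows "\<exists>d>0. \<forall>a b. a \<le> z \<and> z \<le> b \<and> b - a < d \<longrightarrow> finite_band a b"
proof (cases "complex_of_real z \<in> resolvent_set D L")
  case True
  then obtain d where "d > 0" "\<And>a b. a \<le> z \<and> z \<le> b \<and> b - a < d \<Longrightarrow> E a = E b"
    using resolvent_locally_constant by blast
  moreover have "finite_band a b" if "E a = E b" for a b
    unfolding finite_band_def using that by (intro exI[of _ "{}"]) simp
  ultimately show ?thesis by blast
next
  case False
  then have zs: "complex_of_real z \<in> spectrum D L" by (simp add: spectrum_def)
  then have nl: "\<not> complex_of_real z islimpt spectrum D L"
    and "\<exists>B. finite B \<and> eigenspace D L (complex_of_real z) = cspan B"
    using assms by (auto simp: essential_spectrum_def)
  then obtain B where B: "finite B" "eigenspace D L (complex_of_real z) = cspan B" by blast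
  obtain d where d: "d > 0" "\<And>w. w \<in> spectrum D L \<Longrightarrow> w \<noteq> complex_of_real z \<Longrightarrow> dist w (complex_of_real z) \<ge> d"
    using nl unfolding islimpt_approachable by (meson not_le)
  have res: "complex_of_real t \<in> resolvent_set D L" if "t \<noteq> z" "\<bar>t - z\<bar> < d" for t
  proof (rule ccontr)
    assume "complex_of_real t \<notin> resolvent_set D L"
    then have "dist (complex_of_real t) (complex_of_real z) \<ge> d"
      using that by (intro d) (auto simp: spectrum_def)
    then show False using that by (simp add: dist_norm flip: of_real_diff)
  qed
  have "E b x - E a x \<in> eigenspace D L (complex_of_real z)" if ab: "a \<le> z" "z \<le> b" "b - a < d" for a b x
  proof -
    define k where "k = E b x - E a x"
    have k: "E a k = 0" "E b k = k" using ab band_vector[of a b x] by (auto simp: k_def)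
    have bnd: "norm (L k - z *\<^sub>R k) \<le> 2 * s * norm k" if s: "0 < s" "s < d" for s
    proof -
      have "E (z - s) k = 0"
      proof (cases "a \<le> z - s")
        case True
        have "E a = E (z - s)" by (rule resolvent_constant[OF True], rule res) (use s ab in auto)
        then show ?thesis using k by metis
      next
        case False
        then show ?thesis using EE[of "z - s" a k] k by (simp add: E_zero)
      qed
      moreover have "E (z + s) k = k"
      proof (cases "z + s \<le> b")
        case True
        have "E (z + s) = E b" by (rule resolvent_constant[OF True], rule res) (use s ab in auto)
        then show ?thesis using k by metis
      next
        case False
        then show ?thesis using EE[of "z + s" b k] k by simp
      qed
      ultimately show ?thesis using band_norm_bound[of "z - s" z "z + s" k] s by simp
    qed
    have "norm (L k - z *\<^sub>R k) \<le> 0"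
    proof (rule field_le_epsilon)
      fix e :: real assume "e > 0"
      define s where "s = min (d / 2) (e / (2 * (norm k + 1)))"
      have "norm k + 1 > 0" by (simp add: add_nonneg_pos)
      then have s: "0 < s" "s < d" using d(1) \<open>e > 0\<close> by (simp_all add: s_def)
      have "2 * s * norm k \<le> 2 * s * (norm k + 1)" using s by simp
      also have "\<dots> \<le> e"
      proof -
        have "s \<le> e / (2 * (norm k + 1))" by (simp add: s_def)
        moreover have "2 * (norm k + 1) > 0" by (simp add: add_nonneg_pos)
        ultimately have "s * (2 * (norm k + 1)) \<le> e" by (simp only: pos_le_divide_eq)
        then show ?thesis by (simp add: algebra_simps)
      qed
      finally show "norm (L k - z *\<^sub>R k) \<le> 0 + e" using bnd[OF s] by simp
    qed
    then have "L k = complex_of_real z *\<^sub>C k" by (simp add: scaleR_scaleC)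
    then show ?thesis using band_in_D[OF k] by (simp add: eigenspace_def k_def)
  qed
  then have "E b x - E a x \<in> span (B \<union> (\<lambda>b. \<i> *\<^sub>C b) ` B)" if "a \<le> z" "z \<le> b" "b - a < d" for a b x
    using that B(2) cspan_subset_span by blast
  then have "finite_band a b" if "a \<le> z" "z \<le> b" "b - a < d" for a b
    unfolding finite_band_def using that B(1) by (intro exI[of _ "B \<union> (\<lambda>b. \<i> *\<^sub>C b) ` B"]) auto
  then show ?thesis using d(1) by blast
qed

text \<open>Compactness of the interval, in the form of the bisection principle: finite dimension holds
  locally and is preserved when adjacent intervals are joined.\<close>

lemma finite_band_interval:
  assumes "a \<le> b" and "\<And>t. a \<le> t \<Longrightarrow> t \<le> b \<Longrightarrow> complex_of_real t \<notin> essential_spectrum D L"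
  shows "finite_band a b"
  using assms(1)
proof (induction rule: Bolzano)
  case (trans a b c)
  then obtain B B' where B: "finite B" "\<And>x. E b x - E a x \<in> span B"
    "finite B'" "\<And>x. E c x - E b x \<in> span B'"
    unfolding finite_band_def by blast
  have "(E b x - E a x) + (E c x - E b x) \<in> span (B \<union> B')" for x
    using B(2,4) span_mono[of B "B \<union> B'"] span_mono[of B' "B \<union> B'"] by (intro span_add) auto
  then have "E c x - E a x \<in> span (B \<union> B')" for x by (simp add: algebra_simps)
  then show ?case unfolding finite_band_def using B by (intro exI[of _ "B \<union> B'"]) auto
next
  case (local x)
  then show ?case using finite_band_local assms(2) by blast
qed

lemma E_below_spectrum:
  assumes "\<And>t. t \<le> a \<Longrightarrow> complex_of_real t \<in> resolvent_set D L"
  shows "E a x = 0"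
proof -
  have "E t x = E a x" if "t \<le> a" for t
    using resolvent_constant[OF that] assms by auto
  then have "\<forall>\<^sub>F t in at_bot. E t x = E a x"
    unfolding eventually_at_bot_linorder by blast
  then have "((\<lambda>t. E t x) \<longlongrightarrow> E a x) at_bot" by (rule tendsto_eventually)
  then show ?thesis using E_bot tendsto_unique[OF trivial_limit_at_bot_linorder] by blast
qed

text \<open>The spectral family is constant on the gap to the left of 0, so the strong limit \<open>E\<^sub>0\<^sub>-\<close> is reached
  at \<open>- \<eta>\<close> already.\<close>

lemma projection_onto_H2:
  assumes "\<eta> > 0" and res: "\<And>t. - \<eta> \<le> t \<Longrightarrow> t < 0 \<Longrightarrow> complex_of_real t \<in> resolvent_set D L"
  shows "projection_onto (H2 E) x = x - E (- \<eta>) x"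
proof -
  have "E_zero_minus E y = E (- \<eta>) y" for y
  proof -
    obtain n where n: "inverse (real (Suc n)) < \<eta>" using reals_Archimedean[OF \<open>\<eta> > 0\<close>] by blast
    have "E (- 1 / real (Suc k)) y = E (- \<eta>) y" if "k \<ge> n" for k
    proof -
      have "1 / real (Suc k) \<le> inverse (real (Suc n))" using that by (simp add: field_simps)
      then have le: "- \<eta> \<le> - 1 / real (Suc k)" using n by simp
      have "- 1 / real (Suc k) < 0" by simp
      then have "E (- \<eta>) = E (- 1 / real (Suc k))"
        by (intro resolvent_constant[OF le] res) (use le_less_trans in blast)+
      then show ?thesis by simp
    qed
    then have "\<forall>\<^sub>F k in sequentially. E (- 1 / real (Suc k)) y = E (- \<eta>) y"
      unfolding eventually_sequentially by blast
    then show ?thesis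
      unfolding E_zero_minus_def by (intro limI tendsto_eventually)
  qed
  then have H2: "H2 E = {y. E (- \<eta>) y = 0}" by (simp add: H2_def)
  show ?thesis
    unfolding projection_onto_def
  proof (rule the_equality)
    show "x - E (- \<eta>) x \<in> H2 E \<and> (\<forall>z\<in>H2 E. cinner (x - (x - E (- \<eta>) x)) z = 0)"
    proof -
      have "cinner x 0 = 0" 
        using cinner_scaleC_left[of 0 0 x] cinner_commute[of x 0] complex_vector.scale_zero_left[of "0::'a"] by simp
      then show ?thesis by (simp add: H2 E_diff E_idem E_csym)
    qed
    fix y assume y: "y \<in> H2 E \<and> (\<forall>z\<in>H2 E. cinner (x - y) z = 0)"
    define z where "z = y - (x - E (- \<eta>) x)"
    have z: "z \<in> H2 E" using y by (simp add: H2 z_def E_diff E_idem)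
    have "(x - y) \<bullet> z = 0" using y z by (simp add: inner_eq_Re_cinner)
    moreover have "E (- \<eta>) x \<bullet> z = 0" using z by (simp add: H2 E_sym)
    ultimately have "z \<bullet> z = 0" by (simp add: z_def inner_simps)
    then show "y = x - E (- \<eta>) x" by (simp add: z_def)
  qed
qed

end

section \<open>Existence of solutions\<close>

theorem theorem2p3:
  fixes D :: "'a::chilbert_space set"
    and L N :: "'a \<Rightarrow> 'a"
    and E :: "real \<Rightarrow> 'a \<Rightarrow> 'a"
    and \<gamma> \<delta> \<epsilon> :: real
    and h :: 'a
  assumes "separable_space (euclidean :: 'a topology)"
    and "self_adjoint D L"
    and "spectral_family_of D L E"
    and "(INF z\<in>essential_spectrum D L. ereal (Re z)) = 0"
    and "\<delta> > 0" and "complex_of_real ` {-\<delta><..<0} \<subseteq> resolvent_set D L"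
    and "\<gamma> \<ge> 0" and "(INF z\<in>spectrum D L. ereal (Re z)) = ereal (- \<gamma>)"
    and "bounded_operator N"
    and "demicontinuous N"
    and "quasi_monotone N"
    and "\<forall>u::nat \<Rightarrow> 'a. filterlim (\<lambda>k. norm (u k)) at_top sequentially \<longrightarrow>
           (\<lambda>k. norm (N (u k)) / norm (u k)) \<longlonglongrightarrow> 0"
    and "0 < \<epsilon>" and "\<epsilon> < 1"
  shows "\<exists>u\<in>D. \<epsilon> *\<^sub>R projection_onto (H2 E) u + L u + N u = h"
proof -
  interpret spectral_resolution D L E by unfold_locales (fact assms)+
  \<comment> \<open>inside the spectral gap, and at most \<open>\<epsilon> / 2\<close>: the form bound \<open>- \<eta>\<close> for \<open>L\<close> on the range of \<open>I - E (- \<eta>)\<close>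
    is then absorbed by \<open>\<epsilon>\<close>\<close>
  define \<eta> where "\<eta> = min (\<delta> / 2) (min (\<epsilon> / 2) (1 / 2))"
  have \<eta>: "\<eta> > 0" "\<eta> < \<delta>" "\<eta> \<le> \<epsilon> / 2" "\<eta> < 1"
    using assms(5,13) by (auto simp: \<eta>_def)
  define P where "P = E (- \<eta>)"
  have proj: "projection_onto (H2 E) x = x - P x" for x
    unfolding P_def using assms(6) \<eta> by (intro projection_onto_H2) auto
  have below: "E (- \<gamma> - 1) x = 0" for x
  proof (rule E_below_spectrum, rule ccontr)
    fix t assume t: "t \<le> - \<gamma> - 1" "complex_of_real t \<notin> resolvent_set D L"
    then have "ereal (- \<gamma>) \<le> ereal (Re (complex_of_real t))"
      unfolding assms(8)[symmetric] by (intro INF_lower) (simp add: spectrum_def)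
    then show False using t by simp
  qed
  have "finite_band (- \<gamma> - 1) (- \<eta>)"
  proof (rule finite_band_interval)
    show "- \<gamma> - 1 \<le> - \<eta>" using \<eta> assms(7) by simp
    fix t assume t: "t \<le> - \<eta>"
    show "complex_of_real t \<notin> essential_spectrum D L"
    proof
      assume "complex_of_real t \<in> essential_spectrum D L"
      then have "0 \<le> ereal (Re (complex_of_real t))"
        unfolding assms(4)[symmetric] by (rule INF_lower)
      then show False using t \<eta> by simp
    qed
  qed
  then obtain B where B: "finite B" "\<And>x. P x \<in> span B"
    unfolding finite_band_def P_def by (auto simp: below)
  have PD: "P x \<in> D" for x
    unfolding P_def by (rule band_in_D[of "- \<gamma> - 1" _ "- \<eta>"]) (simp_all add: below E_idem)
  \<comment> \<open>indefinite, but definite on each of the ranges of \<open>P\<close> and \<open>I - P\<close>\<close>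
  define A where "A u = \<epsilon> *\<^sub>R (u - P u) + L u" for u
  have P_lin: "linear P" "P (P x) = P x" "P x \<bullet> y = x \<bullet> P y" for x y
    by (simp_all add: P_def E_linear E_idem E_sym)
  have "\<exists>u\<in>D. A u + N u = h"
  proof (rule saddle_equation_solvable[where P = P and B = B and c = \<eta>])
    show "separable_space (euclidean :: 'a topology)" "subspace D" "\<eta> > 0" "finite B"
      "linear P" "\<And>x. P (P x) = P x" "\<And>x y. P x \<bullet> y = x \<bullet> P y"
      by (fact assms D_subspace \<eta> B P_lin)+
    show "range P \<subseteq> span B" "range P \<subseteq> D" using B PD by auto
    show "A (x + y) = A x + A y" if "x \<in> D" "y \<in> D" for x y
      using that by (simp add: A_def L_add linear_add[OF P_lin(1)] algebra_simps)
    show "A (r *\<^sub>R x) = r *\<^sub>R A x" if "x \<in> D" for r x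
      using that by (simp add: A_def L_scaleR linear_scale[OF P_lin(1)] algebra_simps)
    show "A x \<bullet> y = x \<bullet> A y" if "x \<in> D" "y \<in> D" for x y
      using that by (simp add: A_def inner_simps P_lin(3) L_sym)
    show "u \<in> D \<and> A u = w" if *: "\<And>x. x \<in> D \<Longrightarrow> A x \<bullet> u = x \<bullet> w" for u w
    proof -
      have "u \<in> D \<and> L u = w - \<epsilon> *\<^sub>R (u - P u)"
      proof (rule L_maximal)
        fix x assume "x \<in> D"
        from *[OF this] show "L x \<bullet> u = x \<bullet> (w - \<epsilon> *\<^sub>R (u - P u))"
          by (simp add: A_def inner_simps P_lin(3) algebra_simps)
      qed
      then show ?thesis by (simp add: A_def)
    qed
    show "A (P x) \<bullet> P x \<le> - \<eta> * (norm (P x))\<^sup>2" for x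
      using form_upper[OF PD, of "- \<eta>" x] by (simp add: A_def P_lin(2)) (simp add: P_def E_idem)
    show "A x \<bullet> x \<ge> \<eta> * (norm x)\<^sup>2" if "x \<in> D" "P x = 0" for x
    proof -
      have "(2 * \<eta>) * (norm x)\<^sup>2 \<le> \<epsilon> * (norm x)\<^sup>2" using \<eta> by (intro mult_right_mono) auto
      moreover have "L x \<bullet> x \<ge> - \<eta> * (norm x)\<^sup>2"
        using that by (intro form_lower) (simp_all add: P_def)
      moreover have "A x \<bullet> x = \<epsilon> * (norm x)\<^sup>2 + L x \<bullet> x"
        using that by (simp add: A_def inner_simps power2_norm_eq_inner)
      ultimately show ?thesis by (simp add: algebra_simps)
    qed
    show "bounded (N ` S)" if "bounded S" for S
      using assms(9) that by (simp add: bounded_operator_def)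
    show "(\<lambda>k. N (u k) \<bullet> v) \<longlonglongrightarrow> N x \<bullet> v" if "u \<longlonglongrightarrow> x" for u x v
      using assms(10) that by (simp add: demicontinuous_def weakly_converges_real)
    show "\<exists>k\<ge>k0. N (u k) \<bullet> (u k - x) > - e"
      if "\<And>v. (\<lambda>k. u k \<bullet> v) \<longlonglongrightarrow> x \<bullet> v" and "e > 0" for u x e k0
    proof (rule ccontr)
      assume "\<not> ?thesis"
      then have "\<forall>k\<ge>k0. N (u k) \<bullet> (u k - x) \<le> - e" by (simp add: not_less)
      then have "\<forall>\<^sub>F k in sequentially. ereal (N (u k) \<bullet> (u k - x)) \<le> ereal (- e)"
        unfolding eventually_sequentially by auto
      then have "limsup (\<lambda>k. ereal (N (u k) \<bullet> (u k - x))) \<le> ereal (- e)"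
        by (rule Limsup_bounded)
      moreover have "0 \<le> limsup (\<lambda>k. ereal (N (u k) \<bullet> (u k - x)))"
        using assms(11) that(1) by (simp add: quasi_monotone_def weakly_converges_real inner_eq_Re_cinner)
      ultimately have "0 \<le> ereal (- e)" by order
      then show False using \<open>e > 0\<close> by simp
    qed
    show "(\<lambda>k. norm (N (u k)) / norm (u k)) \<longlonglongrightarrow> 0"
      if "filterlim (\<lambda>k. norm (u k)) at_top sequentially" for u :: "nat \<Rightarrow> 'a"
      using assms(12) that by blast
  qed
  then show ?thesis by (simp add: A_def proj)
qed

end
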